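(* Let $[A,(B_{::})]$ be an array of $q\ge 2$ linear time-invariant systems with relative actuation, let $\mathbf{W}$ be its controllability matrix, let $W_{i\sigma}^{[\kappa]}$ ($\kappa=1,\dots,m$) be the matrices defined in the context, and let $k,\ell\in\{1,\dots,q\}$ be distinct. The following are equivalent. 1. The array $[A,(B_{::})]$ is $(k,\ell)$-controllable. 2. The controllability matrix $\mathbf{W}$ is $(k,\ell)$-connected. 3. All the matrices $\mathrm{inc}(W_{::}^{[1]}),\ \mathrm{inc}(W_{::}^{[2]}),\dots,\mathrm{inc}(W_{::}^{[m]})$ are $(k,\ell)$-connected.
   Context: Array. Let $q\ge 2$, $n,p\ge 1$ be integers, $A\in\mathbb{R}^{n\times n}$, and $B_{i\sigma}\in\mathbb{R}^{n\times 1}$ ($i=1,\dots,q$; $\sigma=1,\dots,p$) satisfying $\sum_{i=1}^{q}B_{i\sigma}=0$ for every $\sigma$ (relative actuation). The array $[A,(B_{::})]$ is the collection of systems $\dot x_i=Ax_i+\sum_{\sigma=1}^{p}B_{i\sigma}u_\sigma$, $i=1,\dots,q$, with states $x_i\in\mathbb{R}^n$ and scalar inputs $u_\sigma\in\mathbb{R}$. Input signals are (Lebesgue) integrable functions on bounded intervals. $(k,\ell)$-controllability. For distinct $k,\ell$, the array is $(k,\ell)$-controllable if for each set of initial conditions $(x_1(0),\dots,x_q(0))$ there exist a finite time $\tau>0$ and input signals $u_\sigma:[0,\tau]\to\mathbb{R}$ such that $x_k(\tau)=x_\ell(\tau)$ and $x_i(\tau)=e^{A\tau}x_i(0)$ for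 all $i\ne k,\ell$. Incidence matrix. $M^{*}$ denotes the conjugate transpose of $M$. For a collection of matrices $(C_{i\sigma})_{i=1,\dots,q;\,\sigma=1,\dots,p}$ of equal size, $\mathrm{inc}(C_{::})$ is the block matrix whose $(i,\sigma)$ block is $C_{i\sigma}$. Let $\mathbf{A}=I_q\otimes A$, $\mathbf{B}=\mathrm{inc}(B_{::})\in\mathbb{R}^{qn\times p}$, and $\mathbf{W}=[\mathbf{B}\ \mathbf{A}\mathbf{B}\ \cdots\ \mathbf{A}^{n-1}\mathbf{B}]$ (the controllability matrix). Generalized eigenspaces. $\mu_1,\dots,\mu_m$ are the distinct eigenvalues of $A^{*}$ with algebraic multiplicities $n_1,\dots,n_m$. For each $\kappa$, $U_\kappa\in\mathbb{C}^{n\times n_\kappa}$ is a full column rank matrix with $\mathrm{range}\,U_\kappa=\mathrm{null}\big((A^{*}-\mu_\kappa I_n)^{n_\kappa}\big)$, taken real when $\mu_\kappa$ is real; $A_\kappa\in\mathbb{C}^{n_\kappa\times n_\kappa}$ is the matrix satisfying $A^{*}U_\kappa=U_\kappa A_\kappa^{*}$. Put $B_{i\sigma}^{[\kappa]}=U_\kappa^{*}B_{i\sigma}$ and $W_{i\sigma}^{[\kappa]}=[B_{i\sigma}^{[\kappa]}\ A_\kappa B_{i\sigma}^{[\kappa]}\ \cdots\ A_\kappa^{n_\kappa-1}B_{i\sigma}^{[\kappa]}]$. Connectedness. For a positive integer $d$, $\mathcal{S}_d=\mathrm{range}(\mathbf{1}_q\otimes I_d)$, where $\mathbf{1}_q$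 is the $q$-vector of all ones; a matrix $G$ with $qd$ rows belongs to class-$\mathcal{G}_d$ if $\mathrm{range}\,G\subset\mathcal{S}_d^{\perp}$. With $e_i$ the $i$th standard basis vector of $\mathbb{R}^q$, a class-$\mathcal{G}_d$ matrix $G$ is $(k,\ell)$-connected if $\mathrm{range}\,G\supset\mathrm{range}[(e_k-e_\ell)\otimes I_d]$. For complex matrices, ranges and subspaces are understood over $\mathbb{C}$. Here $\mathbf{W}\in\mathcal{G}_n$ and $\mathrm{inc}(W_{::}^{[\kappa]})\in\mathcal{G}_{n_\kappa}$. *)

theory Defs
  imports "HOL-Analysis.Analysis" "Jordan_Normal_Form.Spectral_Radius" "Jordan_Normal_Form.DL_Rank"
    "Jordan_Normal_Form.Matrix_Kernel"
begin

unbundle no vec_syntax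

text \<open>
  The matrix with \<open>nr \<times> nc\<close> blocks, all of size \<open>r \<times> c\<close>, whose \<open>(i, j)\<close> block is \<open>C i j\<close>.
  Blocks, systems and inputs are numbered from \<open>0\<close>.
\<close>

definition block_mat :: "nat \<Rightarrow> nat \<Rightarrow> nat \<Rightarrow> nat \<Rightarrow> (nat \<Rightarrow> nat \<Rightarrow> 'a mat) \<Rightarrow> 'a mat" where
  "block_mat nr nc r c C =
     mat (nr * r) (nc * c) (\<lambda>(a, b). C (a div r) (b div c) $$ (a mod r, b mod c))"

definition kronecker :: "'a::semiring_0 mat \<Rightarrow> 'a mat \<Rightarrow> 'a mat" where
  "kronecker M N =
     block_mat (dim_row M) (dim_col M) (dim_row N) (dim_col N) (\<lambda>i j. M $$ (i, j) \<cdot>\<^sub>m N)"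

abbreviation inc :: "nat \<Rightarrow> nat \<Rightarrow> nat \<Rightarrow> nat \<Rightarrow> (nat \<Rightarrow> nat \<Rightarrow> 'a mat) \<Rightarrow> 'a mat" where
  "inc \<equiv> block_mat"

text \<open>\<open>ctrb N A B\<close> is \<open>[B, A B, \<dots>, A\<^sup>N\<^sup>-\<^sup>1 B]\<close>.\<close>

definition ctrb :: "nat \<Rightarrow> 'a::semiring_1 mat \<Rightarrow> 'a mat \<Rightarrow> 'a mat" where
  "ctrb N A B = block_mat 1 N (dim_row B) (dim_col B) (\<lambda>_ j. (A ^\<^sub>m j) * B)"

text \<open>
  The definitions up to \<open>pair_connected\<close> are polymorphic: for real matrices, ranges and orthogonal complements are
  over the reals, for complex matrices over the complex numbers.
\<close>

definition orth_compl :: "nat \<Rightarrow> 'a::conjugatable_field vec set \<Rightarrow> 'a vec set" where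
  "orth_compl N S = {v \<in> carrier_vec N. \<forall>w\<in>S. v \<bullet>c w = 0}"

definition sync_space :: "nat \<Rightarrow> nat \<Rightarrow> 'a::conjugatable_field vec set" where
  "sync_space q d = vec_space.col_space (q * d) (kronecker (mat q 1 (\<lambda>_. 1)) (1\<^sub>m d))"

definition class_G :: "nat \<Rightarrow> nat \<Rightarrow> 'a::conjugatable_field mat \<Rightarrow> bool" where
  "class_G q d G \<longleftrightarrow>
     dim_row G = q * d \<and> vec_space.col_space (q * d) G \<subseteq> orth_compl (q * d) (sync_space q d)"

definition pair_connected ::
  "nat \<Rightarrow> nat \<Rightarrow> nat \<Rightarrow> nat \<Rightarrow> 'a::conjugatable_field mat \<Rightarrow> bool" where
  "pair_connected q d k l G \<longleftrightarrow> class_G q d G \<and>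
     vec_space.col_space (q * d)
       (kronecker (mat_of_cols q [unit_vec q k - unit_vec q l]) (1\<^sub>m d))
     \<subseteq> vec_space.col_space (q * d) G"

definition array_rel_act ::
  "nat \<Rightarrow> nat \<Rightarrow> nat \<Rightarrow> real mat \<Rightarrow> (nat \<Rightarrow> nat \<Rightarrow> real mat) \<Rightarrow> bool" where
  "array_rel_act q n p A B \<longleftrightarrow>
     A \<in> carrier_mat n n \<and> (\<forall>i<q. \<forall>\<sigma><p. B i \<sigma> \<in> carrier_mat n 1) \<and>
     (\<forall>\<sigma><p. \<forall>j<n. (\<Sum>i<q. B i \<sigma> $$ (j, 0)) = 0)"

definition array_ctrb ::
  "nat \<Rightarrow> nat \<Rightarrow> nat \<Rightarrow> real mat \<Rightarrow> (nat \<Rightarrow> nat \<Rightarrow> real mat) \<Rightarrow> real mat" where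
  "array_ctrb q n p A B = ctrb n (kronecker (1\<^sub>m q) A) (inc q p n 1 B)"

text \<open>
  Inputs are merely integrable, so \<open>x\<^sub>i' = A x\<^sub>i + \<Sum>\<^sub>\<sigma> B\<^sub>i\<^sub>\<sigma> u\<^sub>\<sigma>\<close> is understood in the sense of
  Caratheodory, i.e. through the integral equation, written here componentwise. It forces \<open>x\<^sub>i\<close>
  to be continuous; for Lebesgue integrable \<open>u\<^sub>\<sigma>\<close> the integrand is then Lebesgue integrable, so
  that the gauge integral agrees with the Lebesgue integral.
\<close>

definition array_trajectory ::
  "nat \<Rightarrow> nat \<Rightarrow> nat \<Rightarrow> real mat \<Rightarrow> (nat \<Rightarrow> nat \<Rightarrow> real mat) \<Rightarrow> real \<Rightarrow>
   (nat \<Rightarrow> real \<Rightarrow> real) \<Rightarrow> (nat \<Rightarrow> real \<Rightarrow> real vec) \<Rightarrow> bool" where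
  "array_trajectory q n p A B \<tau> u x \<longleftrightarrow>
     (\<forall>i<q. \<forall>t\<in>{0..\<tau>}. x i t \<in> carrier_vec n \<and>
       (\<forall>j<n. ((\<lambda>s. (A *\<^sub>v x i s) $ j + (\<Sum>\<sigma><p. B i \<sigma> $$ (j, 0) * u \<sigma> s))
                has_integral (x i t $ j - x i 0 $ j)) {0..t}))"

definition mat_exp :: "real mat \<Rightarrow> real mat" where
  "mat_exp M = mat (dim_row M) (dim_row M) (\<lambda>(i, j). \<Sum>r. (M ^\<^sub>m r) $$ (i, j) / fact r)"

definition pair_controllable ::
  "nat \<Rightarrow> nat \<Rightarrow> nat \<Rightarrow> nat \<Rightarrow> nat \<Rightarrow> real mat \<Rightarrow> (nat \<Rightarrow> nat \<Rightarrow> real mat) \<Rightarrow> bool" where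
  "pair_controllable q n p k l A B \<longleftrightarrow>
     (\<forall>x0. (\<forall>i<q. x0 i \<in> carrier_vec n) \<longrightarrow>
       (\<exists>\<tau> u x. \<tau> > 0 \<and> (\<forall>\<sigma><p. u \<sigma> absolutely_integrable_on {0..\<tau>}) \<and>
          array_trajectory q n p A B \<tau> u x \<and> (\<forall>i<q. x i 0 = x0 i) \<and>
          x k \<tau> = x l \<tau> \<and>
          (\<forall>i<q. i \<noteq> k \<longrightarrow> i \<noteq> l \<longrightarrow> x i \<tau> = mat_exp (\<tau> \<cdot>\<^sub>m A) *\<^sub>v x0 i)))"

abbreviation cmat :: "real mat \<Rightarrow> complex mat" where
  "cmat \<equiv> map_mat complex_of_real"

text \<open>
  \<open>\<mu> 0, \<dots>, \<mu> (m - 1)\<close> enumerate the distinct eigenvalues of \<open>A\<^sup>*\<close>, \<open>N \<kappa>\<close> is the algebraic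
  multiplicity of \<open>\<mu> \<kappa>\<close>, \<open>U \<kappa>\<close> is a basis matrix of the generalized eigenspace, and \<open>Ak \<kappa>\<close> is
  the matrix determined by \<open>A\<^sup>* U\<^sub>\<kappa> = U\<^sub>\<kappa> A\<^sub>\<kappa>\<^sup>*\<close>.
\<close>

definition gen_eigen_data ::
  "nat \<Rightarrow> real mat \<Rightarrow> nat \<Rightarrow> (nat \<Rightarrow> complex) \<Rightarrow> (nat \<Rightarrow> nat) \<Rightarrow>
   (nat \<Rightarrow> complex mat) \<Rightarrow> (nat \<Rightarrow> complex mat) \<Rightarrow> bool" where
  "gen_eigen_data n A m \<mu> N U Ak \<longleftrightarrow>
     bij_betw \<mu> {..<m} (spectrum (mat_adjoint (cmat A))) \<and>
     (\<forall>\<kappa><m.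
        N \<kappa> = Polynomial.order (\<mu> \<kappa>) (char_poly (mat_adjoint (cmat A))) \<and>
        U \<kappa> \<in> carrier_mat n (N \<kappa>) \<and> vec_space.rank n (U \<kappa>) = N \<kappa> \<and>
        vec_space.col_space n (U \<kappa>) =
          mat_kernel ((mat_adjoint (cmat A) - \<mu> \<kappa> \<cdot>\<^sub>m 1\<^sub>m n) ^\<^sub>m N \<kappa>) \<and>
        (\<mu> \<kappa> \<in> \<real> \<longrightarrow> elements_mat (U \<kappa>) \<subseteq> \<real>) \<and>
        Ak \<kappa> \<in> carrier_mat (N \<kappa>) (N \<kappa>) \<and>
        mat_adjoint (cmat A) * U \<kappa> = U \<kappa> * mat_adjoint (Ak \<kappa>))"

text \<open>The matrix \<open>inc(W\<^sub>:\<^sub>:\<^bsup>[\<kappa>]\<^esup>)\<close>, from \<open>d = n\<^sub>\<kappa>\<close>, \<open>U = U\<^sub>\<kappa>\<close> and \<open>Ak = A\<^sub>\<kappa>\<close>.\<close>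

definition modal_inc ::
  "nat \<Rightarrow> nat \<Rightarrow> nat \<Rightarrow> complex mat \<Rightarrow> complex mat \<Rightarrow> (nat \<Rightarrow> nat \<Rightarrow> real mat) \<Rightarrow> complex mat"
where
  "modal_inc q p d U Ak B =
     inc q p d d (\<lambda>i \<sigma>. ctrb d Ak (mat_adjoint U * cmat (B i \<sigma>)))"

end

theory Submission
  imports Defs
begin

text \<open>
  All three statements are reduced to one about annihilators: families \<open>y\<^sub>1, \<dots>, y\<^sub>q\<close> of vectors with
  \<open>\<Sum>\<^sub>i y\<^sub>i\<^sup>T A\<^sup>r B\<^sub>i\<^sub>\<sigma> = 0\<close> for all \<open>r\<close> and \<open>\<sigma>\<close>. By the Fredholm alternative and Cayley-Hamilton, the
  controllability matrix is \<open>(k, l)\<close>-connected if and only if every annihilator satisfies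
  \<open>y\<^sub>k = y\<^sub>l\<close> (\<open>array_ctrb_connected_iff\<close>), and similarly for the modal matrices
  (\<open>modal_inc_connected_iff\<close>).

  Controllability gives \<open>y\<^sub>k = y\<^sub>l\<close> because the outputs \<open>\<Sum>\<^sub>i y\<^sub>i\<^sup>T A\<^sup>r x\<^sub>i(t)\<close> do not see the input: each
  is the derivative of the preceding one, so they are analytic in \<open>t\<close> and vanish identically if all
  of them vanish at one time (\<open>trajectory_annihilator_vanishes\<close>). Steering from opposite initial
  states at \<open>k\<close> and \<open>l\<close>, and zero elsewhere, ends in the zero state, since the sum of the states moves
  freely; hence the outputs vanish at the start, too. Conversely, if \<open>(e\<^sub>k - e\<^sub>l) \<otimes> d\<close> lies in the
  range of the controllability matrix, explicit polynomial inputs, obtained from the companion form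
  and Hermite interpolation (\<open>companion_steering\<close>), realise it as a displacement in unit time. Taking
  \<open>d\<close> to be half the free motion of \<open>l\<close> minus that of \<open>k\<close> makes the two nodes meet.

  For the modal matrices, the relation \<open>U\<^sub>\<kappa>\<^sup>* A = A\<^sub>\<kappa> U\<^sub>\<kappa>\<^sup>*\<close> identifies modal annihilators with the
  complex annihilators whose blocks lie in one generalized eigenspace, up to conjugation. The
  annihilators are invariant under \<open>A\<^sup>*\<close>; if some annihilator had \<open>y\<^sub>k \<noteq> y\<^sub>l\<close>, one killed by as few
  linear factors of the characteristic polynomial as possible would involve a single eigenvalue only
  (\<open>blocks_agree_by_eigenspaces\<close>). So it suffices to test the modal annihilators.
\<close>

section \<open>Ranges and annihilators\<close>

lemma sum_blocks:
  fixes f :: "nat \<Rightarrow> 'a::comm_monoid_add"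
  shows "(\<Sum>a<q*d. f a) = (\<Sum>i<q. \<Sum>j<d. f (i*d+j))"
proof -
  have "(\<Sum>j<d. f (i*d+j)) = sum f {i*d..<i*d+d}" for i
    using sum.shift_bounds_nat_ivl[of f 0 "i*d" d] by (simp add: lessThan_atLeast0 add.commute)
  thus ?thesis by (simp add: sum.nat_group)
qed

lemma all_blocks:
  "(\<forall>a<q*d. P a) \<longleftrightarrow> (\<forall>i<q. \<forall>j<d. P (i*d+j))" for q d :: nat
proof safe
  fix a assume a: "a < q*d" and h: "\<forall>i<q. \<forall>j<d. P (i*d+j)"
  hence "a div d < q" "a mod d < d"
    by (auto simp: less_mult_imp_div_less) (metis mod_less_divisor mult_0_right not_gr_zero not_less0)
  with h have "P (a div d * d + a mod d)" by blast
  thus "P a" by simp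
next
  fix i j assume h: "\<forall>a<q*d. P a" and "i < q" "j < d"
  then have "i*d+j < Suc i * d" by simp
  also have "\<dots> \<le> q*d" using \<open>i < q\<close> by (intro mult_right_mono) auto
  finally show "P (i*d+j)" using h by blast
qed

lemma block_index_less: "i < q \<Longrightarrow> j < d \<Longrightarrow> i*d+j < q*(d::nat)"
  using all_blocks[of q d "\<lambda>a. a < q*d"] by blast

text \<open>
  Over the real or complex numbers this says that the orthogonal complement of the left kernel of
  \<open>G\<close> is the range of \<open>G\<close>. Over an arbitrary field one argues by induction on the columns: if the
  last one is not already annihilated by everything that annihilates the others, some \<open>y0\<close> detects
  it, and subtracting from \<open>v\<close> the multiple \<open>a\<close> of that column which \<open>y0\<close> prescribes reduces the
  problem to the remaining columns.
\<close>

lemma fredholm_alternative: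
  fixes G :: "nat \<Rightarrow> nat \<Rightarrow> 'a::field"
  assumes "\<And>y. (\<And>s. s < M \<Longrightarrow> (\<Sum>i<N. y i * G i s) = 0) \<Longrightarrow> (\<Sum>i<N. y i * v i) = 0"
  shows "\<exists>x. \<forall>i<N. v i = (\<Sum>s<M. G i s * x s)"
  using assms
proof (induction M arbitrary: v)
  case 0
  have "v i = 0" if "i < N" for i
    using 0[of "\<lambda>j. if j = i then 1 else 0"] that by (simp add: if_distrib[of "\<lambda>x. x * _"] cong: if_cong)
  thus ?case by simp
next
  case (Suc M)
  show ?case
  proof (cases "\<forall>y. (\<forall>s<M. (\<Sum>i<N. y i * G i s) = 0) \<longrightarrow> (\<Sum>i<N. y i * G i M) = 0")
    case True
    have "\<exists>x. \<forall>i<N. v i = (\<Sum>s<M. G i s * x s)"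
    proof (rule Suc.IH)
      fix y assume "\<And>s. s < M \<Longrightarrow> (\<Sum>i<N. y i * G i s) = 0"
      with True show "(\<Sum>i<N. y i * v i) = 0"
        by (intro Suc.prems) (metis less_Suc_eq)
    qed
    then obtain x where x: "\<forall>i<N. v i = (\<Sum>s<M. G i s * x s)" by blast
    show ?thesis by (rule exI[of _ "x(M := 0)"]) (use x in simp)
  next
    case False
    then obtain y0 where y0: "\<And>s. s < M \<Longrightarrow> (\<Sum>i<N. y0 i * G i s) = 0"
      and c0: "(\<Sum>i<N. y0 i * G i M) \<noteq> 0" by blast
    define c where "c = (\<Sum>i<N. y0 i * G i M)"
    define a where "a = (\<Sum>i<N. y0 i * v i) / c"
    have c: "c \<noteq> 0" using c0 by (simp add: c_def)
    have "\<exists>x. \<forall>i<N. v i - a * G i M = (\<Sum>s<M. G i s * x s)"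
    proof (rule Suc.IH)
      fix y assume y: "\<And>s. s < M \<Longrightarrow> (\<Sum>i<N. y i * G i s) = 0"
      define b where "b = (\<Sum>i<N. y i * G i M)"
      define e where "e = b / c"
      have lin: "(\<Sum>i<N. (y i - e * y0 i) * w i) = (\<Sum>i<N. y i * w i) - e * (\<Sum>i<N. y0 i * w i)" for w
        by (simp add: algebra_simps sum_subtractf sum_distrib_left)
      have "(\<Sum>i<N. (y i - e * y0 i) * v i) = 0"
      proof (rule Suc.prems)
        fix s assume "s < Suc M"
        then consider "s < M" | "s = M" by linarith
        thus "(\<Sum>i<N. (y i - e * y0 i) * G i s) = 0"
          unfolding lin using y y0 c by cases (auto simp: e_def b_def c_def)
      qed
      hence "(\<Sum>i<N. y i * v i) = e * (\<Sum>i<N. y0 i * v i)" by (simp add: lin)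
      also have "\<dots> = a * b" using c by (simp add: e_def a_def)
      finally show "(\<Sum>i<N. y i * (v i - a * G i M)) = 0"
        by (simp add: b_def algebra_simps sum_subtractf sum_distrib_left)
    qed
    then obtain x where x: "\<forall>i<N. v i - a * G i M = (\<Sum>s<M. G i s * x s)" by blast
    show ?thesis
      by (rule exI[of _ "x(M := a)"]) (use x in \<open>auto simp: algebra_simps\<close>)
  qed
qed

lemma block_mat_index:
  assumes "i < nr" "j < nc" "a < r" "b < c"
  shows "block_mat nr nc r c C $$ (i*r+a, j*c+b) = C i j $$ (a, b)"
  using assms block_index_less[of i nr a r] block_index_less[of j nc b c]
  by (simp add: block_mat_def)

lemma block_mat_carrier [simp]: "block_mat nr nc r c C \<in> carrier_mat (nr*r) (nc*c)"
  by (simp add: block_mat_def)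

lemma mult_mat_vec_nth:
  assumes "G \<in> carrier_mat N M" "x \<in> carrier_vec M" "i < N"
  shows "(G *\<^sub>v x) $ i = (\<Sum>s<M. G $$ (i,s) * x $ s)"
  using assms by (auto simp: scalar_prod_def lessThan_atLeast0)

lemma mult_mat_nth:
  assumes "G \<in> carrier_mat N M" "X \<in> carrier_mat M L" "i < N" "j < L"
  shows "(G * X) $$ (i,j) = (\<Sum>s<M. G $$ (i,s) * X $$ (s,j))"
  using assms by (auto simp: scalar_prod_def lessThan_atLeast0)

lemma sync_space_block:
  assumes "w \<in> (sync_space q d :: 'a::conjugatable_field vec set)"
  shows "\<exists>z. \<forall>i<q. \<forall>j<d. w $ (i*d+j) = z j" "w \<in> carrier_vec (q*d)"
proof -
  define K :: "'a mat" where "K = kronecker (mat q 1 (\<lambda>_. 1)) (1\<^sub>m d)"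
  have K: "K \<in> carrier_mat (q*d) d" by (simp add: K_def kronecker_def block_mat_def)
  have e: "K $$ (i*d+j, s) = (if s = j then 1 else 0)" if "i < q" "j < d" "s < d" for i j s
    using block_mat_index[of i q 0 1 j d s d "\<lambda>i j. mat q 1 (\<lambda>_. 1) $$ (i, j) \<cdot>\<^sub>m 1\<^sub>m d :: 'a mat"] that
    by (simp add: K_def kronecker_def)
  from assms obtain z where z: "z \<in> carrier_vec d" "w = K *\<^sub>v z"
    using K unfolding sync_space_def K_def[symmetric] vec_space.col_space_eq[OF K] by auto
  thus "w \<in> carrier_vec (q*d)" using K by auto
  have "w $ (i*d+j) = z $ j" if "i < q" "j < d" for i j
    unfolding z(2) mult_mat_vec_nth[OF K z(1) block_index_less[OF that]]
    using that by (simp add: e if_distrib[of "\<lambda>x. x * _"] cong: if_cong)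
  thus "\<exists>z. \<forall>i<q. \<forall>j<d. w $ (i*d+j) = z j" by blast
qed

lemma class_G_if_block_sums_zero:
  fixes G :: "'a::conjugatable_field mat"
  assumes G: "G \<in> carrier_mat (q*d) M"
    and sums: "\<And>s j. s < M \<Longrightarrow> j < d \<Longrightarrow> (\<Sum>i<q. G $$ (i*d+j, s)) = 0"
  shows "class_G q d G"
  unfolding class_G_def orth_compl_def
proof (intro conjI subsetI CollectI ballI)
  show "dim_row G = q*d" using G by simp
  fix v assume "v \<in> vec_space.col_space (q*d) G"
  then obtain x where x: "x \<in> carrier_vec M" "v = G *\<^sub>v x" and v: "v \<in> carrier_vec (q*d)"
    using G unfolding vec_space.col_space_eq[OF G] by auto
  show "v \<in> carrier_vec (q*d)" by (rule v)
  fix w :: "'a vec" assume "w \<in> sync_space q d"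
  then obtain z where z: "\<And>i j. i < q \<Longrightarrow> j < d \<Longrightarrow> w $ (i*d+j) = z j" and w: "w \<in> carrier_vec (q*d)"
    using sync_space_block[of w q d] by blast
  have "v \<bullet>c w = (\<Sum>a<q*d. v $ a * conjugate (w $ a))"
    using v w by (simp add: scalar_prod_def lessThan_atLeast0)
  also have "\<dots> = (\<Sum>i<q. \<Sum>j<d. v $ (i*d+j) * conjugate (z j))"
    by (simp add: sum_blocks z)
  also have "\<dots> = (\<Sum>i<q. \<Sum>j<d. \<Sum>s<M. G $$ (i*d+j,s) * x $ s * conjugate (z j))"
    by (simp add: x(2) mult_mat_vec_nth[OF G x(1)] block_index_less sum_distrib_right)
  also have "\<dots> = (\<Sum>j<d. \<Sum>s<M. (\<Sum>i<q. G $$ (i*d+j,s)) * x $ s * conjugate (z j))"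
    by (subst sum.swap, rule sum.cong, simp, subst sum.swap) (simp add: sum_distrib_right)
  also have "\<dots> = 0" by (simp add: sums)
  finally show "v \<bullet>c w = 0" .
qed

text \<open>
  The bridge from ranges to equations. A row vector \<open>y\<close>, cut into \<open>q\<close> blocks, is orthogonal to the
  range of \<open>(e\<^sub>k - e\<^sub>l) \<otimes> I\<close> exactly if its blocks \<open>k\<close> and \<open>l\<close> agree, so by the Fredholm
  alternative connectedness means that every \<open>y\<close> in the left kernel of \<open>G\<close> has this property. The
  pairing is bilinear also over the complex numbers; conjugating it would replace \<open>y\<close> by its
  conjugate, which has equal blocks if and only if \<open>y\<close> has.
\<close>

lemma pair_connected_iff_annihilator:
  fixes G :: "'a::conjugatable_field mat"
  assumes G: "G \<in> carrier_mat (q*d) M" and kl: "k < q" "l < q"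
    and sums: "\<And>s j. s < M \<Longrightarrow> j < d \<Longrightarrow> (\<Sum>i<q. G $$ (i*d+j, s)) = 0"
  shows "pair_connected q d k l G \<longleftrightarrow>
    (\<forall>y. (\<forall>s<M. (\<Sum>i<q. \<Sum>j<d. y i j * G $$ (i*d+j, s)) = 0) \<longrightarrow> (\<forall>j<d. y k j = y l j))"
    (is "_ \<longleftrightarrow> ?R")
proof -
  define E :: "'a mat" where "E = kronecker (mat_of_cols q [unit_vec q k - unit_vec q l]) (1\<^sub>m d)"
  have E: "E \<in> carrier_mat (q*d) d" by (simp add: E_def kronecker_def block_mat_def)
  have e: "E $$ (i*d+j, s) = ((if i = k then 1 else 0) - (if i = l then 1 else 0)) * (if s = j then 1 else 0)"
    if "i < q" "j < d" "s < d" for i j s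
    using block_mat_index[of i q 0 1 j d s d
      "\<lambda>i j. mat_of_cols q [unit_vec q k - unit_vec q l] $$ (i, j) \<cdot>\<^sub>m 1\<^sub>m d :: 'a mat"] that kl
    by (auto simp: E_def kronecker_def mat_of_cols_def)
  have Ez: "(E *\<^sub>v z) $ (i*d+j) = ((if i = k then 1 else 0) - (if i = l then 1 else 0)) * z $ j"
    if "z \<in> carrier_vec d" "i < q" "j < d" for z i j
    unfolding mult_mat_vec_nth[OF E that(1) block_index_less[OF that(2,3)]]
    using that by (simp add: e if_distrib[of "\<lambda>x. x * _"] if_distrib[of "\<lambda>x. _ * x"] cong: if_cong)
  have yEz: "(\<Sum>i<q. \<Sum>j<d. y i j * (E *\<^sub>v z) $ (i*d+j)) = (\<Sum>j<d. (y k j - y l j) * z $ j)"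
    if z: "z \<in> carrier_vec d" for y z
  proof -
    have "(\<Sum>i<q. \<Sum>j<d. y i j * (E *\<^sub>v z) $ (i*d+j))
        = (\<Sum>j<d. \<Sum>i<q. y i j * (((if i = k then 1 else 0) - (if i = l then 1 else 0)) * z $ j))"
      by (subst sum.swap) (simp add: Ez[OF z])
    also have "\<dots> = (\<Sum>j<d. (\<Sum>i<q. (if i = k then y i j * z $ j else 0) - (if i = l then y i j * z $ j else 0)))"
      by (intro sum.cong refl) (auto simp: algebra_simps)
    also have "\<dots> = (\<Sum>j<d. (y k j - y l j) * z $ j)"
      using kl by (simp add: sum_subtractf left_diff_distrib)
    finally show ?thesis .
  qed
  have G_class: "class_G q d G" using class_G_if_block_sums_zero[OF G sums] by blast
  have pc: "pair_connected q d k l G \<longleftrightarrow> vec_space.col_space (q*d) E \<subseteq> vec_space.col_space (q*d) G"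
    using G_class by (simp add: pair_connected_def E_def)
  show ?thesis
  proof
    assume "pair_connected q d k l G"
    hence sub: "vec_space.col_space (q*d) E \<subseteq> vec_space.col_space (q*d) G" by (simp add: pc)
    show ?R
    proof safe
      fix y :: "nat \<Rightarrow> nat \<Rightarrow> 'a" and j
      assume y: "\<forall>s<M. (\<Sum>i<q. \<Sum>j<d. y i j * G $$ (i*d+j, s)) = 0" and j: "j < d"
      let ?z = "unit_vec d j :: 'a vec"
      have z: "?z \<in> carrier_vec d" by simp
      have "E *\<^sub>v ?z \<in> vec_space.col_space (q*d) E"
        unfolding vec_space.col_space_eq[OF E] using E by auto
      then obtain x where x: "x \<in> carrier_vec M" "E *\<^sub>v ?z = G *\<^sub>v x"
        using sub G unfolding vec_space.col_space_eq[OF G] by auto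
      have "y k j - y l j = (\<Sum>j'<d. (y k j' - y l j') * ?z $ j')"
        using j by (simp add: if_distrib[of "\<lambda>x. _ * x"] unit_vec_def cong: if_cong)
      also have "\<dots> = (\<Sum>i<q. \<Sum>j<d. y i j * (G *\<^sub>v x) $ (i*d+j))"
        by (simp add: yEz[OF z, symmetric] x(2))
      also have "\<dots> = (\<Sum>i<q. \<Sum>j<d. \<Sum>s<M. y i j * G $$ (i*d+j,s) * x $ s)"
        by (simp add: mult_mat_vec_nth[OF G x(1)] block_index_less sum_distrib_left mult.assoc)
      also have "\<dots> = (\<Sum>i<q. \<Sum>s<M. \<Sum>j<d. y i j * G $$ (i*d+j,s) * x $ s)"
        by (rule sum.cong[OF refl], rule sum.swap)
      also have "\<dots> = (\<Sum>s<M. (\<Sum>i<q. \<Sum>j<d. y i j * G $$ (i*d+j,s)) * x $ s)"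
        by (subst sum.swap) (simp add: sum_distrib_right)
      also have "\<dots> = 0" using y by simp
      finally show "y k j = y l j" by simp
    qed
  next
    assume R: ?R
    show "pair_connected q d k l G" unfolding pc
    proof
      fix v assume "v \<in> vec_space.col_space (q*d) E"
      then obtain z where z: "z \<in> carrier_vec d" "v = E *\<^sub>v z"
        using E unfolding vec_space.col_space_eq[OF E] by auto
      have v: "v \<in> carrier_vec (q*d)" using z E by auto
      have "\<exists>x. \<forall>a<q*d. v $ a = (\<Sum>s<M. G $$ (a,s) * x s)"
      proof (rule fredholm_alternative)
        fix y assume y: "\<And>s. s < M \<Longrightarrow> (\<Sum>a<q*d. y a * G $$ (a, s)) = 0"
        hence "\<forall>j<d. y (k*d+j) = y (l*d+j)"
          using R[rule_format, of "\<lambda>i j. y (i*d+j)"] by (simp add: sum_blocks)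
        thus "(\<Sum>a<q*d. y a * v $ a) = 0"
          by (simp add: sum_blocks z(2) yEz[OF z(1)])
      qed
      then obtain x where x: "\<forall>a<q*d. v $ a = (\<Sum>s<M. G $$ (a,s) * x s)" by blast
      have "G *\<^sub>v vec M x = v"
      proof (rule eq_vecI)
        fix a assume "a < dim_vec v"
        hence "a < q*d" using v by simp
        thus "(G *\<^sub>v vec M x) $ a = v $ a"
          using mult_mat_vec_nth[OF G, of "vec M x" a] x by simp
      qed (use G v in auto)
      thus "v \<in> vec_space.col_space (q*d) G"
        unfolding vec_space.col_space_eq[OF G] using G v by (auto intro!: bexI[of _ "vec M x"])
    qed
  qed
qed

section \<open>The Cayley-Hamilton theorem\<close>

lemma pow_mat_add:
  assumes "A \<in> carrier_mat n n"
  shows "A ^\<^sub>m (r + s) = A ^\<^sub>m r * A ^\<^sub>m s"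
proof (induction s)
  case (Suc s)
  thus ?case using assms by (simp add: assoc_mult_mat[of _ n n _ n _ n])
qed (use assms in simp)

definition mat_poly :: "'a::comm_ring_1 poly \<Rightarrow> 'a mat \<Rightarrow> 'a mat" where
  "mat_poly p A = mat (dim_row A) (dim_row A) (\<lambda>ij. \<Sum>r\<le>degree p. coeff p r * (A ^\<^sub>m r) $$ ij)"

lemma mat_poly_carrier [simp]: "A \<in> carrier_mat n n \<Longrightarrow> mat_poly p A \<in> carrier_mat n n"
  by (simp add: mat_poly_def)

lemma mat_poly_index:
  assumes "A \<in> carrier_mat n n" "i < n" "j < n" "degree p \<le> m"
  shows "mat_poly p A $$ (i,j) = (\<Sum>r\<le>m. coeff p r * (A ^\<^sub>m r) $$ (i,j))"
proof -
  have "(\<Sum>r\<le>m. coeff p r * (A ^\<^sub>m r) $$ (i,j)) = (\<Sum>r\<le>degree p. coeff p r * (A ^\<^sub>m r) $$ (i,j))"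
    using assms(4) by (intro sum.mono_neutral_right) (auto simp: coeff_eq_0)
  thus ?thesis using assms by (simp add: mat_poly_def)
qed

lemma mat_poly_add_index:
  assumes "A \<in> carrier_mat n n" "i < n" "j < n"
  shows "mat_poly (p + q) A $$ (i,j) = mat_poly p A $$ (i,j) + mat_poly q A $$ (i,j)"
  using degree_add_le_max[of p q]
  by (simp add: mat_poly_index[OF assms, where m = "max (degree p) (degree q)"] algebra_simps sum.distrib)

lemma mat_poly_0_index:
  assumes "A \<in> carrier_mat n n" "i < n" "j < n"
  shows "mat_poly 0 A $$ (i,j) = 0"
  using assms by (simp add: mat_poly_def)

lemma mat_poly_sum_index:
  assumes "A \<in> carrier_mat n n" "i < n" "j < n"
  shows "mat_poly (\<Sum>k\<in>K. f k) A $$ (i,j) = (\<Sum>k\<in>K. mat_poly (f k) A $$ (i,j))"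
  by (induction K rule: infinite_finite_induct)
     (simp_all add: mat_poly_0_index[OF assms] mat_poly_add_index[OF assms])

lemma mat_poly_smult_index:
  assumes "A \<in> carrier_mat n n" "i < n" "j < n"
  shows "mat_poly (Polynomial.smult c p) A $$ (i,j) = c * mat_poly p A $$ (i,j)"
  by (simp add: mat_poly_index[OF assms, where m = "degree p"] degree_smult_le sum_distrib_left mult.assoc)

lemma mat_poly_shift_index:
  assumes A: "A \<in> carrier_mat n n" and ij: "i < n" "j < n"
  shows "mat_poly (pCons 0 p) A $$ (i,j) = (\<Sum>k<n. mat_poly p A $$ (i,k) * A $$ (k,j))"
proof -
  have s: "mat_poly (pCons 0 p) A $$ (i,j) = (\<Sum>r\<le>degree p. coeff p r * (A ^\<^sub>m Suc r) $$ (i,j))"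
    by (subst mat_poly_index[OF assms, where m = "Suc (degree p)"])
       (simp_all add: degree_pCons_le sum.atMost_Suc_shift del: pow_mat.simps sum.atMost_Suc)
  have 1: "(A ^\<^sub>m Suc r) $$ (i,j) = (\<Sum>k<n. (A ^\<^sub>m r) $$ (i,k) * A $$ (k,j))" for r
    using mult_mat_nth[OF pow_carrier_mat[OF A] A ij] by simp
  show "mat_poly (pCons 0 p) A $$ (i,j) = (\<Sum>k<n. mat_poly p A $$ (i,k) * A $$ (k,j))"
    unfolding s 1 using ij
    by (simp add: mat_poly_index[OF A _ _ order_refl] sum_distrib_left sum_distrib_right mult.assoc sum.swap[of _ "{..<n}"])
qed

text \<open>
  Let \<open>M = x I - A\<close>. Row \<open>a\<close> of \<open>p(A)\<close> depends linearly on the polynomial \<open>p\<close>, and multiplying \<open>p\<close>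
  by \<open>x\<close> multiplies that row by \<open>A\<close> from the right. Hence multiplying the row by \<open>M\<close>, with \<open>x\<close>
  acting in this way, gives zero (fact \<open>col\<close>). Multiplying further by the adjugate of \<open>M\<close> replaces \<open>M\<close>
  by \<open>det M = char_poly A\<close>.
\<close>

theorem cayley_hamilton:
  fixes A :: "'a::comm_ring_1 mat"
  assumes A: "A \<in> carrier_mat n n"
  shows "mat_poly (char_poly A) A = 0\<^sub>m n n"
proof (rule eq_matI)
  fix a j assume "a < dim_row (0\<^sub>m n n :: 'a mat)" "j < dim_col (0\<^sub>m n n :: 'a mat)"
  hence a: "a < n" and j: "j < n" by auto
  define M where "M = char_poly_matrix A"
  have M: "M \<in> carrier_mat n n" unfolding M_def using A by simp
  have Mi: "M $$ (i,k) = (if i = k then [:0,1:] else 0) - [:A $$ (i,k):]" if "i < n" "k < n" for i k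
    using that A by (auto simp: M_def char_poly_matrix_def)
  have col: "(\<Sum>i<n. mat_poly (p * M $$ (i,k)) A $$ (a,i)) = 0" if k: "k < n" for p k
  proof -
    have "mat_poly (p * M $$ (i,k)) A $$ (a,i) =
      (if i = k then mat_poly (pCons 0 p) A $$ (a,k) else 0) - mat_poly p A $$ (a,i) * A $$ (i,k)"
      if i: "i < n" for i
    proof -
      have "p * M $$ (i,k) = (if i = k then pCons 0 p else 0) + Polynomial.smult (- (A $$ (i,k))) p"
        by (simp add: Mi[OF i k] algebra_simps)
      show ?thesis
        unfolding \<open>p * M $$ (i,k) = _\<close> mat_poly_add_index[OF A a i] mat_poly_smult_index[OF A a i]
        by (auto simp: mat_poly_0_index[OF A a k] mat_poly_0_index[OF A a i])
    qed
    thus ?thesis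
      using k by (simp add: sum_subtractf mat_poly_shift_index[OF A a k])
  qed
  have adj: "(\<Sum>k<n. adj_mat M $$ (k,j) * M $$ (i,k)) = (if i = j then char_poly A else 0)" if i: "i < n" for i
  proof -
    have "(\<Sum>k<n. M $$ (i,k) * adj_mat M $$ (k,j)) = (M * adj_mat M) $$ (i,j)"
      by (rule mult_mat_nth[OF M adj_mat(1)[OF M] i j, symmetric])
    also have "\<dots> = (if i = j then char_poly A else 0)"
      unfolding adj_mat(2)[OF M] using i j by (simp add: char_poly_def M_def)
    finally show ?thesis by (simp add: mult.commute)
  qed
  have "0 = (\<Sum>k<n. \<Sum>i<n. mat_poly (adj_mat M $$ (k,j) * M $$ (i,k)) A $$ (a,i))"
    by (simp add: col)
  also have "\<dots> = (\<Sum>i<n. mat_poly (\<Sum>k<n. adj_mat M $$ (k,j) * M $$ (i,k)) A $$ (a,i))"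
    by (subst sum.swap) (simp add: mat_poly_sum_index[OF A a])
  also have "\<dots> = (\<Sum>i<n. if i = j then mat_poly (char_poly A) A $$ (a,i) else 0)"
    by (intro sum.cong refl) (simp add: adj mat_poly_0_index[OF A a])
  also have "\<dots> = mat_poly (char_poly A) A $$ (a,j)" using j by simp
  finally show "mat_poly (char_poly A) A $$ (a,j) = 0\<^sub>m n n $$ (a,j)" using a j by simp
qed (use A in \<open>auto simp: mat_poly_def\<close>)

lemma char_poly_recurrence:
  fixes A :: "'a::field mat"
  assumes A: "A \<in> carrier_mat n n" and X: "X \<in> carrier_mat n c" and j: "j < n" "b < c"
  shows "(\<Sum>r\<le>n. coeff (char_poly A) r * (A ^\<^sub>m r * X) $$ (j,b)) = 0"
proof -
  have deg: "degree (char_poly A) \<le> n" using degree_monic_char_poly[OF A] by simp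
  have "(\<Sum>r\<le>n. coeff (char_poly A) r * (A ^\<^sub>m r * X) $$ (j,b)) =
      (\<Sum>r\<le>n. \<Sum>s<n. coeff (char_poly A) r * (A ^\<^sub>m r) $$ (j,s) * X $$ (s,b))"
    by (simp add: mult_mat_nth[OF pow_carrier_mat[OF A] X j] sum_distrib_left mult.assoc)
  also have "\<dots> = (\<Sum>s<n. (\<Sum>r\<le>n. coeff (char_poly A) r * (A ^\<^sub>m r) $$ (j,s)) * X $$ (s,b))"
    by (subst sum.swap) (simp add: sum_distrib_right)
  also have "\<dots> = (\<Sum>s<n. mat_poly (char_poly A) A $$ (j,s) * X $$ (s,b))"
    by (simp add: mat_poly_index[OF A j(1) _ deg])
  also have "\<dots> = 0" unfolding cayley_hamilton[OF A] using j by simp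
  finally show ?thesis .
qed

section \<open>Annihilators of the controllability matrices\<close>

text \<open>
  All powers \<open>r\<close> are included, not only those below \<open>n\<close> that occur in the controllability matrix: in
  this form the set of annihilators is visibly invariant under the transpose of \<open>A\<close>.
\<close>

definition ctrb_annihilator ::
    "nat \<Rightarrow> nat \<Rightarrow> nat \<Rightarrow> 'a::comm_semiring_1 mat \<Rightarrow> (nat \<Rightarrow> nat \<Rightarrow> 'a mat) \<Rightarrow> (nat \<Rightarrow> nat \<Rightarrow> 'a) \<Rightarrow> bool" where
  "ctrb_annihilator q n p A B y \<longleftrightarrow>
    (\<forall>r. \<forall>\<sigma><p. (\<Sum>i<q. \<Sum>j<n. y i j * (A ^\<^sub>m r * B i \<sigma>) $$ (j,0)) = 0)"

text \<open>
  By Cayley-Hamilton the values for \<open>r \<ge> n\<close> are linear combinations of the previous \<open>n\<close> values.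
\<close>

lemma ctrb_annihilator_finite:
  fixes A :: "'a::field mat"
  assumes A: "A \<in> carrier_mat n n" and B: "\<And>i \<sigma>. i < q \<Longrightarrow> \<sigma> < p \<Longrightarrow> B i \<sigma> \<in> carrier_mat n 1"
  shows "ctrb_annihilator q n p A B y \<longleftrightarrow>
    (\<forall>r<n. \<forall>\<sigma><p. (\<Sum>i<q. \<Sum>j<n. y i j * (A ^\<^sub>m r * B i \<sigma>) $$ (j,0)) = 0)"
proof
  define f where "f \<sigma> r = (\<Sum>i<q. \<Sum>j<n. y i j * (A ^\<^sub>m r * B i \<sigma>) $$ (j,0))" for \<sigma> r
  assume "\<forall>r<n. \<forall>\<sigma><p. (\<Sum>i<q. \<Sum>j<n. y i j * (A ^\<^sub>m r * B i \<sigma>) $$ (j,0)) = 0"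
  hence base: "f \<sigma> r = 0" if "r < n" "\<sigma> < p" for r \<sigma> using that by (simp add: f_def)
  let ?c = "coeff (char_poly A)"
  have rec: "(\<Sum>s\<le>n. ?c s * f \<sigma> (r + s)) = 0" if \<sigma>: "\<sigma> < p" for \<sigma> r
  proof -
    have Bc: "A ^\<^sub>m r * B i \<sigma> \<in> carrier_mat n 1" if "i < q" for i
      by (rule mult_carrier_mat[OF pow_carrier_mat[OF A] B[OF that \<sigma>]])
    have pw: "A ^\<^sub>m (r + s) * B i \<sigma> = A ^\<^sub>m s * (A ^\<^sub>m r * B i \<sigma>)" if "i < q" for i s
      using pow_mat_add[OF A, of s r] A B[OF that \<sigma>]
      by (simp add: add.commute assoc_mult_mat[of _ n n _ n _ 1])
    have "(\<Sum>s\<le>n. ?c s * f \<sigma> (r + s)) =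
        (\<Sum>s\<le>n. \<Sum>i<q. \<Sum>j<n. y i j * (?c s * (A ^\<^sub>m s * (A ^\<^sub>m r * B i \<sigma>)) $$ (j,0)))"
      by (simp add: f_def pw sum_distrib_left mult.left_commute)
    also have "\<dots> = (\<Sum>i<q. \<Sum>s\<le>n. \<Sum>j<n. y i j * (?c s * (A ^\<^sub>m s * (A ^\<^sub>m r * B i \<sigma>)) $$ (j,0)))"
      by (rule sum.swap)
    also have "\<dots> = (\<Sum>i<q. \<Sum>j<n. y i j * (\<Sum>s\<le>n. ?c s * (A ^\<^sub>m s * (A ^\<^sub>m r * B i \<sigma>)) $$ (j,0)))"
      by (rule sum.cong[OF refl], subst sum.swap) (simp add: sum_distrib_left)
    also have "\<dots> = 0"
      using char_poly_recurrence[OF A Bc] by simp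
    finally show ?thesis .
  qed
  have "f \<sigma> r = 0" if \<sigma>: "\<sigma> < p" for \<sigma> r
  proof (induction r rule: less_induct)
    case (less r)
    show ?case
    proof (cases "r < n")
      case False
      hence "f \<sigma> (r - n + s) = 0" if "s < n" for s using less[of "r - n + s"] that by simp
      hence "(\<Sum>s<n. ?c s * f \<sigma> (r - n + s)) = 0" by simp
      hence "?c n * f \<sigma> (r - n + n) = 0"
        using rec[OF \<sigma>, of "r - n"] by (simp add: lessThan_Suc_atMost[symmetric])
      thus ?thesis using False degree_monic_char_poly[OF A] by simp
    qed (use base \<sigma> in auto)
  qed
  thus "ctrb_annihilator q n p A B y" by (simp add: ctrb_annihilator_def f_def)
qed (auto simp: ctrb_annihilator_def)

text \<open>
  A common left factor preserves the relation that the input matrices of one input sum to zero. It is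
  applied to powers of \<open>A\<close>, and to \<open>U\<^sup>*\<close> for the modal matrices; both \<open>class_G\<close> conditions follow.
\<close>

lemma relative_actuation_mult:
  fixes A :: "'a::comm_semiring_1 mat"
  assumes M: "M \<in> carrier_mat d n" and B: "\<And>i. i < q \<Longrightarrow> B i \<in> carrier_mat n 1"
    and s: "\<And>j. j < n \<Longrightarrow> (\<Sum>i<q. B i $$ (j,0)) = 0" and j: "j < d"
  shows "(\<Sum>i<q. (M * B i) $$ (j,0)) = (0::'a)"
proof -
  have "(\<Sum>i<q. (M * B i) $$ (j,0)) = (\<Sum>i<q. \<Sum>a<n. M $$ (j,a) * B i $$ (a,0))"
    using mult_mat_nth[OF M B j] by simp
  also have "\<dots> = (\<Sum>a<n. M $$ (j,a) * (\<Sum>i<q. B i $$ (a,0)))"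
    by (subst sum.swap) (simp add: sum_distrib_left)
  finally show ?thesis by (simp add: s)
qed

lemma kronecker_id_mult_inc:
  fixes A :: "'a::comm_semiring_1 mat"
  assumes A: "A \<in> carrier_mat n n" and B: "\<And>i \<sigma>. i < q \<Longrightarrow> \<sigma> < p \<Longrightarrow> B i \<sigma> \<in> carrier_mat n 1"
  shows "kronecker (1\<^sub>m q) A * inc q p n 1 B = inc q p n 1 (\<lambda>i \<sigma>. A * B i \<sigma>)"
proof -
  let ?K = "kronecker (1\<^sub>m q) A"
  have K: "?K \<in> carrier_mat (q*n) (q*n)" using A by (simp add: kronecker_def block_mat_def)
  have Ki: "?K $$ (i*n+a, j*n+b) = (if i = j then A $$ (a,b) else 0)"
    if "i < q" "j < q" "a < n" "b < n" for i j a b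
    using that A block_mat_index[of i q j q a n b n "\<lambda>i j. 1\<^sub>m q $$ (i,j) \<cdot>\<^sub>m A"]
    by (simp add: kronecker_def)
  have I: "inc q p n 1 B \<in> carrier_mat (q*n) p" for B :: "nat \<Rightarrow> nat \<Rightarrow> 'a mat"
    using block_mat_carrier[of q p n 1 B] by simp
  have "\<forall>a<q*n. \<forall>\<sigma><p. (?K * inc q p n 1 B) $$ (a,\<sigma>) = inc q p n 1 (\<lambda>i \<sigma>. A * B i \<sigma>) $$ (a,\<sigma>)"
    unfolding all_blocks
  proof (intro allI impI)
    fix i a \<sigma> assume i: "i < q" and a: "a < n" and \<sigma>: "\<sigma> < p"
    have Bi: "inc q p n 1 C $$ (j*n+b, \<sigma>) = C j \<sigma> $$ (b,0)" if "j < q" "b < n" for j b and C :: "nat \<Rightarrow> nat \<Rightarrow> 'a mat"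
      using block_mat_index[of j q \<sigma> p b n 0 1 C] that \<sigma> by simp
    have "(?K * inc q p n 1 B) $$ (i*n+a,\<sigma>) =
        (\<Sum>j<q. \<Sum>b<n. ?K $$ (i*n+a,j*n+b) * inc q p n 1 B $$ (j*n+b, \<sigma>))"
      by (simp only: mult_mat_nth[OF K I block_index_less[OF i a] \<sigma>] sum_blocks)
    also have "\<dots> = (\<Sum>j<q. if i = j then (\<Sum>b<n. A $$ (a,b) * B j \<sigma> $$ (b,0)) else 0)"
      by (intro sum.cong refl) (use i a in \<open>simp add: Ki Bi del: One_nat_def\<close>)
    also have "\<dots> = (A * B i \<sigma>) $$ (a,0)"
      using i mult_mat_nth[OF A B[OF i \<sigma>] a, of 0] by simp
    also have "\<dots> = inc q p n 1 (\<lambda>i \<sigma>. A * B i \<sigma>) $$ (i*n+a,\<sigma>)" by (simp add: Bi i a del: One_nat_def)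
    finally show "(?K * inc q p n 1 B) $$ (i*n+a,\<sigma>) = inc q p n 1 (\<lambda>i \<sigma>. A * B i \<sigma>) $$ (i*n+a,\<sigma>)" .
  qed
  thus ?thesis using K I by (intro eq_matI) (auto simp: kronecker_def block_mat_def)
qed

lemma kronecker_id_pow_mult_inc:
  fixes A :: "'a::comm_semiring_1 mat"
  assumes A: "A \<in> carrier_mat n n" and B: "\<And>i \<sigma>. i < q \<Longrightarrow> \<sigma> < p \<Longrightarrow> B i \<sigma> \<in> carrier_mat n 1"
  shows "kronecker (1\<^sub>m q) A ^\<^sub>m r * inc q p n 1 B = inc q p n 1 (\<lambda>i \<sigma>. A ^\<^sub>m r * B i \<sigma>)"
  using B
proof (induction r arbitrary: B)
  let ?K = "kronecker (1\<^sub>m q) A"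
  have K: "?K \<in> carrier_mat (q*n) (q*n)" using A by (simp add: kronecker_def block_mat_def)
  have cong: "inc q p n 1 C = inc q p n 1 D" if "\<And>i \<sigma>. i < q \<Longrightarrow> \<sigma> < p \<Longrightarrow> C i \<sigma> = D i \<sigma>"
    for C D :: "nat \<Rightarrow> nat \<Rightarrow> 'a mat"
    using that by (intro eq_matI) (auto simp: block_mat_def less_mult_imp_div_less)
  {
    case 0
    have "?K ^\<^sub>m 0 * inc q p n 1 B = inc q p n 1 B"
      using left_mult_one_mat[OF block_mat_carrier, of q n p 1 B] K by simp
    also have "\<dots> = inc q p n 1 (\<lambda>i \<sigma>. A ^\<^sub>m 0 * B i \<sigma>)"
      by (intro cong) (use A 0 in \<open>simp add: left_mult_one_mat[of _ n 1]\<close>)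
    finally show ?case .
  next
    case (Suc r)
    have k: "?K * inc q p n 1 B = inc q p n 1 (\<lambda>i \<sigma>. A * B i \<sigma>)"
      by (rule kronecker_id_mult_inc[OF A]) (rule Suc.prems)
    have "?K ^\<^sub>m Suc r * inc q p n 1 B = ?K ^\<^sub>m r * (?K * inc q p n 1 B)"
      using assoc_mult_mat[OF pow_carrier_mat[OF K, of r] K block_mat_carrier[of q p n 1 B]] by simp
    also have "\<dots> = inc q p n 1 (\<lambda>i \<sigma>. A ^\<^sub>m r * (A * B i \<sigma>))"
      unfolding k by (rule Suc.IH, rule mult_carrier_mat[OF A Suc.prems])
    also have "\<dots> = inc q p n 1 (\<lambda>i \<sigma>. A ^\<^sub>m Suc r * B i \<sigma>)"
      by (intro cong) (use A Suc.prems in \<open>auto simp: assoc_mult_mat[of _ n n _ n _ 1]\<close>)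
    finally show ?case .
  }
qed

lemma array_ctrb_index:
  assumes A: "A \<in> carrier_mat n n" and B: "\<And>i \<sigma>. i < q \<Longrightarrow> \<sigma> < p \<Longrightarrow> B i \<sigma> \<in> carrier_mat n 1"
    and "r < n" "\<sigma> < p" "i < q" "j < n"
  shows "array_ctrb q n p A B $$ (i*n+j, r*p+\<sigma>) = (A ^\<^sub>m r * B i \<sigma>) $$ (j,0)"
proof -
  have "array_ctrb q n p A B $$ (i*n+j, r*p+\<sigma>) =
      (kronecker (1\<^sub>m q) A ^\<^sub>m r * inc q p n 1 B) $$ (i*n+j, \<sigma>)"
    using block_mat_index[of 0 1 r n "i*n+j" "q*n" \<sigma> p] block_index_less[of i q j n] assms(3-)
    by (simp add: array_ctrb_def ctrb_def carrier_matD[OF block_mat_carrier])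
  also have "\<dots> = (A ^\<^sub>m r * B i \<sigma>) $$ (j,0)"
    using block_mat_index[of i q \<sigma> p j n 0 1] assms(3-)
    by (simp add: kronecker_id_pow_mult_inc[of A n q p B, OF A B] del: One_nat_def)
  finally show ?thesis .
qed

text \<open>
  The columns of the controllability matrix are the vectors \<open>(A\<^sup>r B\<^sub>i\<^sub>\<sigma>)\<^sub>i\<close>, so its left kernel
  consists of the annihilators.
\<close>

lemma array_ctrb_connected_iff:
  assumes rel: "array_rel_act q n p A B" and kl: "k < q" "l < q"
  shows "pair_connected q n k l (array_ctrb q n p A B) \<longleftrightarrow>
    (\<forall>y. ctrb_annihilator q n p A B y \<longrightarrow> (\<forall>j<n. y k j = y l j))"
proof -
  have A: "A \<in> carrier_mat n n" and B: "\<And>i \<sigma>. i < q \<Longrightarrow> \<sigma> < p \<Longrightarrow> B i \<sigma> \<in> carrier_mat n 1"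
    and s: "\<And>\<sigma> j. \<sigma> < p \<Longrightarrow> j < n \<Longrightarrow> (\<Sum>i<q. B i \<sigma> $$ (j,0)) = 0"
    using rel by (auto simp: array_rel_act_def)
  note W = array_ctrb_index[OF A B]
  have c: "array_ctrb q n p A B \<in> carrier_mat (q*n) (n*p)"
    by (simp add: array_ctrb_def ctrb_def block_mat_def)
  have z: "\<forall>s<n*p. \<forall>j<n. (\<Sum>i<q. array_ctrb q n p A B $$ (i*n+j, s)) = 0"
    unfolding all_blocks
    using relative_actuation_mult[OF pow_carrier_mat[OF A] B s] by (simp add: W)
  have "pair_connected q n k l (array_ctrb q n p A B) \<longleftrightarrow>
      (\<forall>y. (\<forall>s<n*p. (\<Sum>i<q. \<Sum>j<n. y i j * array_ctrb q n p A B $$ (i*n+j, s)) = 0) \<longrightarrow>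
        (\<forall>j<n. y k j = y l j))"
    by (rule pair_connected_iff_annihilator[OF c kl]) (simp add: z)
  also have "\<dots> \<longleftrightarrow> (\<forall>y. ctrb_annihilator q n p A B y \<longrightarrow> (\<forall>j<n. y k j = y l j))"
  proof (rule all_cong1)
    fix y :: "nat \<Rightarrow> nat \<Rightarrow> real"
    have "ctrb_annihilator q n p A B y \<longleftrightarrow>
        (\<forall>r<n. \<forall>\<sigma><p. (\<Sum>i<q. \<Sum>j<n. y i j * (A ^\<^sub>m r * B i \<sigma>) $$ (j,0)) = 0)"
      by (rule ctrb_annihilator_finite[OF A B])
    also have "\<dots> \<longleftrightarrow> (\<forall>s<n*p. (\<Sum>i<q. \<Sum>j<n. y i j * array_ctrb q n p A B $$ (i*n+j, s)) = 0)"
      unfolding all_blocks by (simp add: W)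
    finally show "((\<forall>s<n*p. (\<Sum>i<q. \<Sum>j<n. y i j * array_ctrb q n p A B $$ (i*n+j, s)) = 0) \<longrightarrow>
        (\<forall>j<n. y k j = y l j)) \<longleftrightarrow> (ctrb_annihilator q n p A B y \<longrightarrow> (\<forall>j<n. y k j = y l j))"
      by simp
  qed
  finally show ?thesis .
qed

lemma mat_adjoint_index [simp]:
  "i < dim_col A \<Longrightarrow> j < dim_row A \<Longrightarrow> mat_adjoint A $$ (i,j) = conjugate (A $$ (j,i))"
  by (simp add: mat_adjoint_def mat_of_rows_def)

lemma mat_adjoint_dim [simp]: "dim_row (mat_adjoint A) = dim_col A" "dim_col (mat_adjoint A) = dim_row A"
  by (simp_all add: mat_adjoint_def)

lemma mat_adjoint_carrier [simp]: "A \<in> carrier_mat n m \<Longrightarrow> mat_adjoint A \<in> carrier_mat m n"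
  by (metis carrier_matD carrier_matI mat_adjoint_dim)

lemma modal_inc_connected_iff:
  fixes U Ak :: "complex mat"
  assumes rel: "array_rel_act q n p A B" and kl: "k < q" "l < q"
    and U: "U \<in> carrier_mat n d" and Ak: "Ak \<in> carrier_mat d d"
  shows "pair_connected q d k l (modal_inc q p d U Ak B) \<longleftrightarrow>
    (\<forall>z. ctrb_annihilator q d p Ak (\<lambda>i \<sigma>. mat_adjoint U * cmat (B i \<sigma>)) z \<longrightarrow> (\<forall>j<d. z k j = z l j))"
proof -
  define B' where "B' i \<sigma> = mat_adjoint U * cmat (B i \<sigma>)" for i \<sigma>
  have Bc: "\<And>i \<sigma>. i < q \<Longrightarrow> \<sigma> < p \<Longrightarrow> cmat (B i \<sigma>) \<in> carrier_mat n 1"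
    and s: "\<And>\<sigma> j. \<sigma> < p \<Longrightarrow> j < n \<Longrightarrow> (\<Sum>i<q. cmat (B i \<sigma>) $$ (j,0)) = 0"
  proof -
    fix \<sigma> j assume h: "\<sigma> < p" "j < n"
    have "B i \<sigma> \<in> carrier_mat n 1" if "i < q" for i
      using rel h that unfolding array_rel_act_def by blast
    hence "(\<Sum>i<q. cmat (B i \<sigma>) $$ (j,0)) = of_real (\<Sum>i<q. B i \<sigma> $$ (j,0))"
      unfolding of_real_sum by (intro sum.cong refl) (use h in force)
    also have "(\<Sum>i<q. B i \<sigma> $$ (j,0)) = 0" using rel h by (simp add: array_rel_act_def)
    finally show "(\<Sum>i<q. cmat (B i \<sigma>) $$ (j,0)) = 0" by simp
  qed (use rel in \<open>auto simp: array_rel_act_def\<close>)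
  have B': "B' i \<sigma> \<in> carrier_mat d 1" if "i < q" "\<sigma> < p" for i \<sigma>
    unfolding B'_def using Bc[OF that] U by (intro mult_carrier_mat) auto
  have s': "(\<Sum>i<q. B' i \<sigma> $$ (j,0)) = 0" if "\<sigma> < p" "j < d" for \<sigma> j
    unfolding B'_def by (rule relative_actuation_mult[OF mat_adjoint_carrier[OF U] Bc s]) (use that in auto)
  have W: "modal_inc q p d U Ak B $$ (i*d+j, \<sigma>*d+r) = (Ak ^\<^sub>m r * B' i \<sigma>) $$ (j,0)"
    if "i < q" "j < d" "\<sigma> < p" "r < d" for i j \<sigma> r
    using block_mat_index[of i q \<sigma> p j d r d "\<lambda>i \<sigma>. ctrb d Ak (B' i \<sigma>)"]
      block_mat_index[of 0 1 r d j d 0 1 "\<lambda>_ r. Ak ^\<^sub>m r * B' i \<sigma>"] that B'[of i \<sigma>]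
    by (simp add: modal_inc_def B'_def[symmetric] ctrb_def)
  have c: "modal_inc q p d U Ak B \<in> carrier_mat (q*d) (p*d)"
    by (simp add: modal_inc_def)
  have z: "\<forall>s<p*d. \<forall>j<d. (\<Sum>i<q. modal_inc q p d U Ak B $$ (i*d+j, s)) = 0"
    unfolding all_blocks
    using relative_actuation_mult[OF pow_carrier_mat[OF Ak] B' s'] by (simp add: W)
  let ?G = "modal_inc q p d U Ak B"
  have "pair_connected q d k l ?G \<longleftrightarrow>
      (\<forall>y. (\<forall>s<p*d. (\<Sum>i<q. \<Sum>j<d. y i j * ?G $$ (i*d+j, s)) = 0) \<longrightarrow> (\<forall>j<d. y k j = y l j))"
    by (rule pair_connected_iff_annihilator[OF c kl]) (simp add: z)
  also have "\<dots> \<longleftrightarrow> (\<forall>y. ctrb_annihilator q d p Ak B' y \<longrightarrow> (\<forall>j<d. y k j = y l j))"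
  proof (rule all_cong1)
    fix y :: "nat \<Rightarrow> nat \<Rightarrow> complex"
    have "ctrb_annihilator q d p Ak B' y \<longleftrightarrow>
        (\<forall>r<d. \<forall>\<sigma><p. (\<Sum>i<q. \<Sum>j<d. y i j * (Ak ^\<^sub>m r * B' i \<sigma>) $$ (j,0)) = 0)"
      by (rule ctrb_annihilator_finite[OF Ak B'])
    also have "\<dots> \<longleftrightarrow> (\<forall>\<sigma><p. \<forall>r<d. (\<Sum>i<q. \<Sum>j<d. y i j * (Ak ^\<^sub>m r * B' i \<sigma>) $$ (j,0)) = 0)"
      by blast
    also have "\<dots> \<longleftrightarrow> (\<forall>s<p*d. (\<Sum>i<q. \<Sum>j<d. y i j * ?G $$ (i*d+j, s)) = 0)"
      unfolding all_blocks by (simp add: W)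
    finally show "((\<forall>s<p*d. (\<Sum>i<q. \<Sum>j<d. y i j * ?G $$ (i*d+j, s)) = 0) \<longrightarrow>
        (\<forall>j<d. y k j = y l j)) \<longleftrightarrow> (ctrb_annihilator q d p Ak B' y \<longrightarrow> (\<forall>j<d. y k j = y l j))"
      by simp
  qed
  also have "B' = (\<lambda>i \<sigma>. mat_adjoint U * cmat (B i \<sigma>))" by (intro ext B'_def)
  finally show ?thesis .
qed

section \<open>Annihilators in modal coordinates\<close>

text \<open>
  \<open>rank\<close> is the dimension of the span of the set of columns, so repeated columns have to be excluded
  before full rank can be read as linear independence.
\<close>

lemma full_rank_injective:
  fixes U :: "'a::field mat"
  assumes U: "U \<in> carrier_mat n d" and rank: "vec_space.rank n U = d"
    and v: "v \<in> carrier_vec d" "U *\<^sub>v v = 0\<^sub>v n"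
  shows "v = 0\<^sub>v d"
proof -
  interpret vec_space "TYPE('a)" n .
  have "distinct (cols U)"
  proof (rule ccontr)
    assume nd: "\<not> distinct (cols U)"
    obtain S where S: "maximal S (\<lambda>T. T \<subseteq> set (cols U) \<and> lin_indpt T)"
      using maximal_exists[of "\<lambda>T. T \<subseteq> set (cols U) \<and> lin_indpt T" "card (set (cols U))" "{}"]
      by (meson List.finite_set card_mono empty_iff empty_subsetI finite_lin_indpt2 rev_finite_subset)
    have "d = card S" using rank_card_indpt[OF U S] rank by simp
    also have "\<dots> \<le> card (set (cols U))" using S by (intro card_mono) (auto simp: maximal_def)
    also have "\<dots> < d" using nd U card_length[of "cols U"] card_distinct[of "cols U"] by fastforce
    finally show False by simp
  qed
  thus ?thesis
    using lin_depI[OF U v(1) _ v(2)] full_rank_lin_indpt[OF U rank] by blast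
qed

lemma mat_adjoint_mult:
  fixes X Y :: "'a::conjugatable_field mat"
  assumes X: "X \<in> carrier_mat n m" and Y: "Y \<in> carrier_mat m d"
  shows "mat_adjoint (X * Y) = mat_adjoint Y * mat_adjoint X"
proof (rule eq_matI)
  fix i j assume "i < dim_row (mat_adjoint Y * mat_adjoint X)" "j < dim_col (mat_adjoint Y * mat_adjoint X)"
  hence ij: "i < d" "j < n" using X Y by auto
  show "mat_adjoint (X * Y) $$ (i,j) = (mat_adjoint Y * mat_adjoint X) $$ (i,j)"
    unfolding mult_mat_nth[OF mat_adjoint_carrier[OF Y] mat_adjoint_carrier[OF X] ij]
    using mult_mat_nth[OF X Y ij(2,1)] ij X Y
    by (simp add: sum_conjugate conjugate_dist_mul mult.commute)
qed (use X Y in auto)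

lemma mat_adjoint_mat_adjoint [simp]:
  "mat_adjoint (mat_adjoint X) = (X :: 'a::conjugatable_field mat)"
  by (rule eq_matI) auto

text \<open>
  The intertwining relation, adjoined, reads \<open>U\<^sup>* C = A\<^sub>\<kappa> U\<^sup>*\<close>, so \<open>A\<^sub>\<kappa>\<^sup>r U\<^sup>* B = U\<^sup>* C\<^sup>r B\<close>.
  Annihilators of the modal system are therefore the annihilators of the original one whose blocks lie
  in the range of the entrywise conjugate of \<open>U\<close>.
\<close>

lemma ctrb_annihilator_modal:
  fixes C U Ak :: "complex mat"
  assumes C: "C \<in> carrier_mat n n" and U: "U \<in> carrier_mat n d" and Ak: "Ak \<in> carrier_mat d d"
    and inter: "mat_adjoint C * U = U * mat_adjoint Ak"
    and B: "\<And>i \<sigma>. i < q \<Longrightarrow> \<sigma> < p \<Longrightarrow> B i \<sigma> \<in> carrier_mat n 1"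
  shows "ctrb_annihilator q d p Ak (\<lambda>i \<sigma>. mat_adjoint U * B i \<sigma>) z \<longleftrightarrow>
    ctrb_annihilator q n p C B (\<lambda>i a. \<Sum>j<d. cnj (U $$ (a,j)) * z i j)"
proof -
  let ?V = "mat_adjoint U"
  have V: "?V \<in> carrier_mat d n" using U by simp
  have VC: "Ak * ?V = ?V * C"
    using arg_cong[OF inter, of mat_adjoint]
      mat_adjoint_mult[OF mat_adjoint_carrier[OF C] U] mat_adjoint_mult[OF U mat_adjoint_carrier[OF Ak]]
    by simp
  have pw: "Ak ^\<^sub>m r * ?V = ?V * C ^\<^sub>m r" for r
  proof (induction r)
    case 0
    show ?case using left_mult_one_mat[OF V] right_mult_one_mat[OF V] C Ak by simp
  next
    case (Suc r)
    have "Ak ^\<^sub>m Suc r * ?V = Ak ^\<^sub>m r * (?V * C)"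
      using assoc_mult_mat[OF pow_carrier_mat[OF Ak, of r] Ak V] by (simp add: VC)
    also have "\<dots> = ?V * C ^\<^sub>m r * C"
      using assoc_mult_mat[OF pow_carrier_mat[OF Ak, of r] V C] by (simp add: Suc)
    also have "\<dots> = ?V * C ^\<^sub>m Suc r"
      using assoc_mult_mat[OF V pow_carrier_mat[OF C, of r] C] by simp
    finally show ?case .
  qed
  have "(\<Sum>j<d. z i j * (Ak ^\<^sub>m r * (?V * B i \<sigma>)) $$ (j,0)) =
      (\<Sum>a<n. (\<Sum>j<d. cnj (U $$ (a,j)) * z i j) * (C ^\<^sub>m r * B i \<sigma>) $$ (a,0))"
    if i: "i < q" and \<sigma>: "\<sigma> < p" for i \<sigma> r
  proof -
    note Bi = B[OF i \<sigma>]
    have CB: "C ^\<^sub>m r * B i \<sigma> \<in> carrier_mat n 1" by (rule mult_carrier_mat[OF pow_carrier_mat[OF C] Bi])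
    have eq: "Ak ^\<^sub>m r * (?V * B i \<sigma>) = ?V * (C ^\<^sub>m r * B i \<sigma>)"
      using assoc_mult_mat[OF pow_carrier_mat[OF Ak, of r] V Bi]
        assoc_mult_mat[OF V pow_carrier_mat[OF C, of r] Bi] by (simp add: pw)
    have "(\<Sum>j<d. z i j * (Ak ^\<^sub>m r * (?V * B i \<sigma>)) $$ (j,0)) =
        (\<Sum>j<d. z i j * (\<Sum>a<n. cnj (U $$ (a,j)) * (C ^\<^sub>m r * B i \<sigma>) $$ (a,0)))"
      unfolding eq by (intro sum.cong refl) (use mult_mat_nth[OF V CB] U in simp)
    also have "\<dots> = (\<Sum>a<n. (\<Sum>j<d. cnj (U $$ (a,j)) * z i j) * (C ^\<^sub>m r * B i \<sigma>) $$ (a,0))"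
      unfolding sum_distrib_left sum_distrib_right by (subst sum.swap) (simp add: mult_ac)
    finally show ?thesis .
  qed
  thus ?thesis by (simp add: ctrb_annihilator_def)
qed

lemma ctrb_annihilator_cmat:
  assumes A: "A \<in> carrier_mat n n" and B: "\<And>i \<sigma>. i < q \<Longrightarrow> \<sigma> < p \<Longrightarrow> B i \<sigma> \<in> carrier_mat n 1"
  shows "ctrb_annihilator q n p (cmat A) (\<lambda>i \<sigma>. cmat (B i \<sigma>)) y \<longleftrightarrow>
    ctrb_annihilator q n p A B (\<lambda>i j. Re (y i j)) \<and> ctrb_annihilator q n p A B (\<lambda>i j. Im (y i j))"
proof -
  have e: "(cmat A ^\<^sub>m r * cmat (B i \<sigma>)) $$ (j,0) = of_real ((A ^\<^sub>m r * B i \<sigma>) $$ (j,0))"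
    if "i < q" "\<sigma> < p" "j < n" for r i \<sigma> j
  proof -
    have c: "A ^\<^sub>m r * B i \<sigma> \<in> carrier_mat n 1"
      by (rule mult_carrier_mat[OF pow_carrier_mat[OF A] B[OF that(1,2)]])
    have "cmat A ^\<^sub>m r * cmat (B i \<sigma>) = cmat (A ^\<^sub>m r * B i \<sigma>)"
      unfolding of_real_hom.mat_hom_pow[OF A, of r, symmetric]
      by (rule of_real_hom.mat_hom_mult[OF pow_carrier_mat[OF A] B[OF that(1,2)], symmetric])
    moreover define X where "X = A ^\<^sub>m r * B i \<sigma>"
    ultimately show ?thesis using c that(3) unfolding X_def[symmetric] by simp
  qed
  have "(\<Sum>i<q. \<Sum>j<n. y i j * (cmat A ^\<^sub>m r * cmat (B i \<sigma>)) $$ (j,0)) = 0 \<longleftrightarrow>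
      (\<Sum>i<q. \<Sum>j<n. Re (y i j) * (A ^\<^sub>m r * B i \<sigma>) $$ (j,0)) = 0 \<and>
      (\<Sum>i<q. \<Sum>j<n. Im (y i j) * (A ^\<^sub>m r * B i \<sigma>) $$ (j,0)) = 0" if \<sigma>: "\<sigma> < p" for \<sigma> r
  proof -
    define w where "w i j = (A ^\<^sub>m r * B i \<sigma>) $$ (j,0)" for i j
    have "(\<Sum>i<q. \<Sum>j<n. y i j * (cmat A ^\<^sub>m r * cmat (B i \<sigma>)) $$ (j,0)) = (\<Sum>i<q. \<Sum>j<n. y i j * of_real (w i j))"
      unfolding w_def by (intro sum.cong refl) (simp only: e \<sigma> lessThan_iff)
    thus ?thesis by (simp add: complex_eq_iff w_def[symmetric])
  qed
  thus ?thesis by (auto simp: ctrb_annihilator_def)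
qed

text \<open>
  Because \<open>A\<close> and the \<open>B\<^sub>i\<^sub>\<sigma>\<close> are real, the annihilators are closed under conjugation. This reconciles
  the range of \<open>U\<close>, a generalized eigenspace of \<open>A\<^sup>*\<close>, with the range of the conjugate of \<open>U\<close>, which
  appears in the modal annihilators.
\<close>

lemma ctrb_annihilator_cnj:
  assumes A: "A \<in> carrier_mat n n" and B: "\<And>i \<sigma>. i < q \<Longrightarrow> \<sigma> < p \<Longrightarrow> B i \<sigma> \<in> carrier_mat n 1"
    and "ctrb_annihilator q n p (cmat A) (\<lambda>i \<sigma>. cmat (B i \<sigma>)) y"
  shows "ctrb_annihilator q n p (cmat A) (\<lambda>i \<sigma>. cmat (B i \<sigma>)) (\<lambda>i j. cnj (y i j))"
proof -
  have "ctrb_annihilator q n p A B (\<lambda>i j. Re (y i j)) \<and> ctrb_annihilator q n p A B (\<lambda>i j. Im (y i j))"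
    by (rule ctrb_annihilator_cmat[OF A B, THEN iffD1]) (use assms(3) in auto)
  hence "ctrb_annihilator q n p A B (\<lambda>i j. Re (cnj (y i j))) \<and> ctrb_annihilator q n p A B (\<lambda>i j. Im (cnj (y i j)))"
    by (simp add: ctrb_annihilator_def sum_negf)
  thus ?thesis by (intro ctrb_annihilator_cmat[OF A B, THEN iffD2]) auto
qed

text \<open>
  Invariance of the annihilators under \<open>C\<^sup>T - \<mu> I\<close>, acting on all blocks simultaneously: moving \<open>C\<^sup>T\<close>
  to the other side of the pairing raises the power of \<open>C\<close> by one.
\<close>

lemma ctrb_annihilator_step:
  fixes C :: "'a::field mat"
  assumes C: "C \<in> carrier_mat n n" and B: "\<And>i \<sigma>. i < q \<Longrightarrow> \<sigma> < p \<Longrightarrow> B i \<sigma> \<in> carrier_mat n 1"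
    and ann: "ctrb_annihilator q n p C B y"
  shows "ctrb_annihilator q n p C B (\<lambda>i j. (\<Sum>a<n. C $$ (a,j) * y i a) - \<mu> * y i j)"
  unfolding ctrb_annihilator_def
proof (intro allI impI)
  fix r \<sigma> assume \<sigma>: "\<sigma> < p"
  define w where "w r i j = (C ^\<^sub>m r * B i \<sigma>) $$ (j,0)" for r i j
  have w: "w (Suc r) i a = (\<Sum>j<n. C $$ (a,j) * w r i j)" if "i < q" "a < n" for i a
  proof -
    have "C ^\<^sub>m Suc r * B i \<sigma> = C * (C ^\<^sub>m r * B i \<sigma>)"
      using pow_mat_add[OF C, of 1 r] C assoc_mult_mat[OF C pow_carrier_mat[OF C, of r] B[OF that(1) \<sigma>]] by simp
    thus ?thesis unfolding w_def
      using mult_mat_nth[OF C mult_carrier_mat[OF pow_carrier_mat[OF C, of r] B[OF that(1) \<sigma>]] that(2)] by simp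
  qed
  have 0: "(\<Sum>i<q. \<Sum>j<n. y i j * w s i j) = 0" for s
    using ann \<sigma> by (simp add: ctrb_annihilator_def w_def)
  have "(\<Sum>i<q. \<Sum>j<n. (\<Sum>a<n. C $$ (a,j) * y i a) * w r i j) = (\<Sum>i<q. \<Sum>a<n. y i a * w (Suc r) i a)"
  proof (rule sum.cong[OF refl])
    fix i assume "i \<in> {..<q}"
    hence "(\<Sum>a<n. y i a * w (Suc r) i a) = (\<Sum>a<n. \<Sum>j<n. C $$ (a,j) * y i a * w r i j)"
      by (simp add: w sum_distrib_left mult_ac)
    thus "(\<Sum>j<n. (\<Sum>a<n. C $$ (a,j) * y i a) * w r i j) = (\<Sum>a<n. y i a * w (Suc r) i a)"
      by (simp only: sum_distrib_right) (rule sum.swap)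
  qed
  hence "(\<Sum>i<q. \<Sum>j<n. (\<Sum>a<n. C $$ (a,j) * y i a) * w r i j) - \<mu> * (\<Sum>i<q. \<Sum>j<n. y i j * w r i j) = 0"
    by (simp add: 0)
  thus "(\<Sum>i<q. \<Sum>j<n. ((\<Sum>a<n. C $$ (a,j) * y i a) - \<mu> * y i j) * (C ^\<^sub>m r * B i \<sigma>) $$ (j,0)) = 0"
    by (simp add: w_def left_diff_distrib sum_subtractf sum_distrib_left mult.assoc)
qed

section \<open>Splitting along generalized eigenspaces\<close>

text \<open>
  The matrix \<open>\<Prod>\<^sub>a (T - a I)\<close>. The list of roots is kept because the argument below removes one root
  at a time.
\<close>

primrec linear_factors_mat :: "'a::field mat \<Rightarrow> 'a list \<Rightarrow> 'a mat" where
  "linear_factors_mat T [] = 1\<^sub>m (dim_row T)"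
| "linear_factors_mat T (a # as) = linear_factors_mat T as * (T - a \<cdot>\<^sub>m 1\<^sub>m (dim_row T))"

lemma linear_factors_mat_carrier [simp]:
  "T \<in> carrier_mat n n \<Longrightarrow> linear_factors_mat T as \<in> carrier_mat n n"
  by (induction as) auto

lemma minus_smult_one_index:
  "T \<in> carrier_mat n n \<Longrightarrow> i < n \<Longrightarrow> j < n \<Longrightarrow>
    (T - a \<cdot>\<^sub>m 1\<^sub>m n) $$ (i,j) = T $$ (i,j) - (if i = j then a else (0::'a::field))"
  by auto

lemma shifts_commute:
  fixes T :: "'a::field mat"
  assumes T: "T \<in> carrier_mat n n"
  shows "(T - a \<cdot>\<^sub>m 1\<^sub>m n) * (T - b \<cdot>\<^sub>m 1\<^sub>m n) = (T - b \<cdot>\<^sub>m 1\<^sub>m n) * (T - a \<cdot>\<^sub>m 1\<^sub>m n)"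
proof (rule eq_matI)
  have c: "T - x \<cdot>\<^sub>m 1\<^sub>m n \<in> carrier_mat n n" for x using T by auto
  fix i j assume "i < dim_row ((T - b \<cdot>\<^sub>m 1\<^sub>m n) * (T - a \<cdot>\<^sub>m 1\<^sub>m n))" "j < dim_col ((T - b \<cdot>\<^sub>m 1\<^sub>m n) * (T - a \<cdot>\<^sub>m 1\<^sub>m n))"
  hence ij: "i < n" "j < n" using T by auto
  have "((T - x \<cdot>\<^sub>m 1\<^sub>m n) * (T - y \<cdot>\<^sub>m 1\<^sub>m n)) $$ (i,j) =
     (\<Sum>s<n. T $$ (i,s) * T $$ (s,j)) - x * T $$ (i,j) - y * T $$ (i,j) + (if i = j then x * y else 0)" for x y
  proof -
    have "((T - x \<cdot>\<^sub>m 1\<^sub>m n) * (T - y \<cdot>\<^sub>m 1\<^sub>m n)) $$ (i,j) =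
      (\<Sum>s<n. T $$ (i,s) * T $$ (s,j) - (if s = i then x * T $$ (i,j) else 0)
         - (if s = j then y * T $$ (i,j) else 0) + (if s = i then (if i = j then x * y else 0) else 0))"
      unfolding mult_mat_nth[OF c c ij]
      by (intro sum.cong refl) (use ij T in \<open>auto simp: minus_smult_one_index[OF T] algebra_simps simp del: index_minus_mat\<close>)
    thus ?thesis using ij by (simp add: sum.distrib sum_subtractf)
  qed
  thus "((T - a \<cdot>\<^sub>m 1\<^sub>m n) * (T - b \<cdot>\<^sub>m 1\<^sub>m n)) $$ (i,j) = ((T - b \<cdot>\<^sub>m 1\<^sub>m n) * (T - a \<cdot>\<^sub>m 1\<^sub>m n)) $$ (i,j)"
    by (simp add: mult.commute)
qed (use T in auto)

lemma linear_factors_mat_remove1: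
  fixes T :: "'a::field mat"
  assumes T: "T \<in> carrier_mat n n"
  shows "x \<in> set as \<Longrightarrow> linear_factors_mat T as = linear_factors_mat T (remove1 x as) * (T - x \<cdot>\<^sub>m 1\<^sub>m n)"
proof (induction as)
  case (Cons a as)
  have c: "T - x \<cdot>\<^sub>m 1\<^sub>m n \<in> carrier_mat n n" for x using T by auto
  have l: "linear_factors_mat T as \<in> carrier_mat n n" for as using T by simp
  show ?case
  proof (cases "x = a")
    case False
    hence "linear_factors_mat T (a # as) = linear_factors_mat T (remove1 x as) * (T - x \<cdot>\<^sub>m 1\<^sub>m n) * (T - a \<cdot>\<^sub>m 1\<^sub>m n)"
      using Cons T by simp
    also have "\<dots> = linear_factors_mat T (remove1 x as) * (T - a \<cdot>\<^sub>m 1\<^sub>m n) * (T - x \<cdot>\<^sub>m 1\<^sub>m n)"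
      by (simp only: assoc_mult_mat[OF l c c] shifts_commute[OF T, of x a])
    finally show ?thesis using False T by simp
  qed (use T in simp)
qed simp

lemma linear_factors_mat_replicate:
  assumes T: "T \<in> carrier_mat n n"
  shows "linear_factors_mat T (replicate e a) = (T - a \<cdot>\<^sub>m 1\<^sub>m n) ^\<^sub>m e"
  using T by (induction e) auto

lemma mat_poly_linear_factors:
  fixes T :: "'a::field mat"
  assumes T: "T \<in> carrier_mat n n"
  shows "mat_poly (\<Prod>a\<leftarrow>as. [:- a, 1:]) T = linear_factors_mat T as"
proof (induction as)
  case Nil
  show ?case using T by (intro eq_matI) (auto simp: mat_poly_def)
next
  case (Cons a as)
  let ?p = "\<Prod>a\<leftarrow>as. [:- a, 1:]"
  have c: "T - a \<cdot>\<^sub>m 1\<^sub>m n \<in> carrier_mat n n" using T by auto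
  have "mat_poly ([:- a, 1:] * ?p) T = mat_poly ?p T * (T - a \<cdot>\<^sub>m 1\<^sub>m n)"
  proof (rule eq_matI)
    fix i j assume "i < dim_row (mat_poly ?p T * (T - a \<cdot>\<^sub>m 1\<^sub>m n))" "j < dim_col (mat_poly ?p T * (T - a \<cdot>\<^sub>m 1\<^sub>m n))"
    hence ij: "i < n" "j < n" using T by (auto simp: mat_poly_def)
    have "[:- a, 1:] * ?p = pCons 0 ?p + Polynomial.smult (- a) ?p" by simp
    hence "mat_poly ([:- a, 1:] * ?p) T $$ (i,j) =
        (\<Sum>k<n. mat_poly ?p T $$ (i,k) * T $$ (k,j)) - a * mat_poly ?p T $$ (i,j)"
      by (simp only: mat_poly_add_index[OF T ij] mat_poly_smult_index[OF T ij] mat_poly_shift_index[OF T ij])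
         simp
    also have "\<dots> = (\<Sum>k<n. mat_poly ?p T $$ (i,k) * (T - a \<cdot>\<^sub>m 1\<^sub>m n) $$ (k,j))"
    proof -
      have "(\<Sum>k<n. mat_poly ?p T $$ (i,k) * (T - a \<cdot>\<^sub>m 1\<^sub>m n) $$ (k,j)) =
        (\<Sum>k<n. mat_poly ?p T $$ (i,k) * T $$ (k,j) - (if k = j then a * mat_poly ?p T $$ (i,j) else 0))"
        by (intro sum.cong refl) (use ij in \<open>auto simp: minus_smult_one_index[OF T] algebra_simps simp del: index_minus_mat\<close>)
      thus ?thesis using ij by (simp add: sum_subtractf)
    qed
    also have "\<dots> = (mat_poly ?p T * (T - a \<cdot>\<^sub>m 1\<^sub>m n)) $$ (i,j)"
      by (rule mult_mat_nth[OF mat_poly_carrier[OF T] c ij, symmetric])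
    finally show "mat_poly ([:- a, 1:] * ?p) T $$ (i,j) = (mat_poly ?p T * (T - a \<cdot>\<^sub>m 1\<^sub>m n)) $$ (i,j)" .
  qed (use T in \<open>auto simp: mat_poly_def\<close>)
  thus ?case using Cons T by simp
qed

lemma count_list_le_order:
  fixes as :: "'a::field list"
  shows "count_list as x \<le> Polynomial.order x (\<Prod>a\<leftarrow>as. [:- a, 1:])"
proof -
  have "(\<Prod>a\<leftarrow>as. [:- a, 1:]) \<noteq> 0" by (auto simp: prod_list_zero_iff)
  moreover have "[:- x, 1:] ^ count_list as x dvd (\<Prod>a\<leftarrow>as. [:- a, 1:])"
    by (induction as) (auto intro: mult_dvd_mono dvd_mult simp del: mult_pCons_left)
  ultimately show ?thesis using order_divides by blast
qed

lemma minus_smult_one_mult_vec: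
  fixes T :: "'a::field mat"
  assumes T: "T \<in> carrier_mat n n" and v: "v \<in> carrier_vec n" and j: "j < n"
  shows "((T - a \<cdot>\<^sub>m 1\<^sub>m n) *\<^sub>v v) $ j = (\<Sum>s<n. T $$ (j,s) * v $ s) - a * v $ j"
proof -
  have c: "T - a \<cdot>\<^sub>m 1\<^sub>m n \<in> carrier_mat n n" using T by auto
  have "((T - a \<cdot>\<^sub>m 1\<^sub>m n) *\<^sub>v v) $ j = (\<Sum>s<n. T $$ (j,s) * v $ s - (if s = j then a * v $ j else 0))"
    unfolding mult_mat_vec_nth[OF c v j]
    by (intro sum.cong refl) (use j in \<open>auto simp: minus_smult_one_index[OF T] algebra_simps simp del: index_minus_mat\<close>)
  thus ?thesis using j by (simp add: sum_subtractf)
qed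

text \<open>
  Reduction to single eigenvalues. Let \<open>S\<close> be invariant under all \<open>T - a I\<close>. Suppose that \<open>c k = c l\<close>
  is known for those \<open>c \<in> S\<close> that are killed by a power of one \<open>T - a I\<close>, and let \<open>c\<close> be killed by a
  product of several factors. If two distinct roots \<open>x\<close> and \<open>y\<close> occur, then \<open>(T - x I) c\<close> and
  \<open>(T - y I) c\<close> are killed by shorter products, so by induction \<open>T - x I\<close> and \<open>T - y I\<close> both annihilate
  \<open>D = c k - c l\<close>; thus \<open>(x - y) D = 0\<close> and \<open>D = 0\<close>. This replaces a decomposition of \<open>c\<close> into
  generalized eigenvectors.
\<close>

lemma blocks_agree_by_eigenspaces:
  fixes T :: "'a::field mat" and S :: "(nat \<Rightarrow> 'a vec) set"
  assumes T: "T \<in> carrier_mat n n"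
    and carr: "\<And>c i. c \<in> S \<Longrightarrow> c i \<in> carrier_vec n"
    and inv: "\<And>c a. c \<in> S \<Longrightarrow> (\<lambda>i. (T - a \<cdot>\<^sub>m 1\<^sub>m n) *\<^sub>v c i) \<in> S"
    and eig: "\<And>c a e. c \<in> S \<Longrightarrow> e \<le> N a \<Longrightarrow> (\<And>i. (T - a \<cdot>\<^sub>m 1\<^sub>m n) ^\<^sub>m e *\<^sub>v c i = 0\<^sub>v n) \<Longrightarrow> c k = c l"
    and "c \<in> S" "\<And>i. linear_factors_mat T as *\<^sub>v c i = 0\<^sub>v n" "\<And>x. count_list as x \<le> N x"
  shows "c k = c l"
  using assms(5-)
proof (induction "length as" arbitrary: as c rule: less_induct)
  case less
  show ?case
  proof (cases "\<exists>x\<in>set as. \<exists>y\<in>set as. x \<noteq> y")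
    case False
    then obtain a where a: "\<forall>x\<in>set as. x = a" by blast
    hence as: "as = replicate (length as) a" by (simp add: replicate_length_same)
    have "count_list as a = length as" using a by (induction as) auto
    hence "length as \<le> N a" using less.prems(3)[of a] by simp
    moreover have "(T - a \<cdot>\<^sub>m 1\<^sub>m n) ^\<^sub>m length as *\<^sub>v c i = 0\<^sub>v n" for i
      using less.prems(2)[of i] linear_factors_mat_replicate[OF T, of "length as" a] as by simp
    ultimately show ?thesis using eig[OF less.prems(1)] by blast
  next
    case True
    then obtain x y where xy: "x \<in> set as" "y \<in> set as" "x \<noteq> y" by blast
    have step: "(T - a \<cdot>\<^sub>m 1\<^sub>m n) *\<^sub>v c k = (T - a \<cdot>\<^sub>m 1\<^sub>m n) *\<^sub>v c l" if a: "a \<in> set as" for a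
    proof (rule less.hyps[of "remove1 a as" "\<lambda>i. (T - a \<cdot>\<^sub>m 1\<^sub>m n) *\<^sub>v c i"])
      show "length (remove1 a as) < length as"
        using length_pos_if_in_set[OF a] by (simp add: length_remove1 a)
      show "(\<lambda>i. (T - a \<cdot>\<^sub>m 1\<^sub>m n) *\<^sub>v c i) \<in> S" by (rule inv[OF less.prems(1)])
      have M: "T - a \<cdot>\<^sub>m 1\<^sub>m n \<in> carrier_mat n n" using T by auto
      fix i
      have "linear_factors_mat T (remove1 a as) *\<^sub>v ((T - a \<cdot>\<^sub>m 1\<^sub>m n) *\<^sub>v c i) = linear_factors_mat T as *\<^sub>v c i"
        unfolding linear_factors_mat_remove1[OF T a]
        by (rule assoc_mult_mat_vec[OF linear_factors_mat_carrier[OF T] M carr[OF less.prems(1)], symmetric])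
      thus "linear_factors_mat T (remove1 a as) *\<^sub>v ((T - a \<cdot>\<^sub>m 1\<^sub>m n) *\<^sub>v c i) = 0\<^sub>v n"
        using less.prems(2) by simp
    next
      fix z
      have "count_list (remove1 a as) z \<le> count_list as z" by (induction as) auto
      thus "count_list (remove1 a as) z \<le> N z" using less.prems(3)[of z] by simp
    qed
    have ck: "c i \<in> carrier_vec n" for i by (rule carr[OF less.prems(1)])
    show ?thesis
    proof (rule eq_vecI)
      fix j assume "j < dim_vec (c l)"
      hence j: "j < n" using ck[of l] by simp
      have "a * (c k $ j - c l $ j) = (\<Sum>s<n. T $$ (j,s) * c k $ s) - (\<Sum>s<n. T $$ (j,s) * c l $ s)"
        if "a \<in> set as" for a
      proof -
        have "(\<Sum>s<n. T $$ (j,s) * c k $ s) - a * c k $ j = (\<Sum>s<n. T $$ (j,s) * c l $ s) - a * c l $ j"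
          using arg_cong[OF step[OF that], of "\<lambda>v. v $ j"] by (simp only: minus_smult_one_mult_vec[OF T ck j])
        thus ?thesis by (simp add: algebra_simps)
      qed
      hence "x * (c k $ j - c l $ j) = y * (c k $ j - c l $ j)" using xy by simp
      thus "c k $ j = c l $ j" using xy(3) by simp
    qed (use ck[of k] ck[of l] in simp)
  qed
qed

text \<open>
  Both sides are statements about complex annihilators, real ones being real and imaginary parts of
  these. The modal annihilators form a part of all annihilators, and injectivity of \<open>U\<^sub>\<kappa>\<close> carries the
  agreement of blocks back to the coordinates; this is one direction. For the other, an annihilator is
  killed by the product of the linear factors of the characteristic polynomial, so that
  \<open>blocks_agree_by_eigenspaces\<close> leaves the annihilators with blocks in one generalized eigenspace.
\<close>

theorem array_ctrb_connected_iff_modal: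
  assumes rel: "array_rel_act q n p A B" and data: "gen_eigen_data n A m \<mu> N U Ak"
    and kl: "k < q" "l < q"
  shows "pair_connected q n k l (array_ctrb q n p A B) \<longleftrightarrow>
    (\<forall>\<kappa><m. pair_connected q (N \<kappa>) k l (modal_inc q p (N \<kappa>) (U \<kappa>) (Ak \<kappa>) B))"
proof -
  have A: "A \<in> carrier_mat n n" and B: "\<And>i \<sigma>. i < q \<Longrightarrow> \<sigma> < p \<Longrightarrow> B i \<sigma> \<in> carrier_mat n 1"
    using rel by (auto simp: array_rel_act_def)
  define T where "T = mat_adjoint (cmat A)"
  have C: "cmat A \<in> carrier_mat n n" using A by simp
  have Bc: "\<And>i \<sigma>. i < q \<Longrightarrow> \<sigma> < p \<Longrightarrow> cmat (B i \<sigma>) \<in> carrier_mat n 1" using B by simp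
  have T: "T \<in> carrier_mat n n" using C by (simp add: T_def)
  have Ti: "T $$ (i,j) = cmat A $$ (j,i)" if "i < n" "j < n" for i j
    using that A by (simp add: T_def)
  define ann where "ann = ctrb_annihilator q n p (cmat A) (\<lambda>i \<sigma>. cmat (B i \<sigma>))"
  have bij: "bij_betw \<mu> {..<m} (spectrum T)"
    and N: "\<And>\<kappa>. \<kappa> < m \<Longrightarrow> N \<kappa> = Polynomial.order (\<mu> \<kappa>) (char_poly T)"
    and U: "\<And>\<kappa>. \<kappa> < m \<Longrightarrow> U \<kappa> \<in> carrier_mat n (N \<kappa>)"
    and rank: "\<And>\<kappa>. \<kappa> < m \<Longrightarrow> vec_space.rank n (U \<kappa>) = N \<kappa>"
    and range: "\<And>\<kappa>. \<kappa> < m \<Longrightarrow> vec_space.col_space n (U \<kappa>) = mat_kernel ((T - \<mu> \<kappa> \<cdot>\<^sub>m 1\<^sub>m n) ^\<^sub>m N \<kappa>)"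
    and Ak: "\<And>\<kappa>. \<kappa> < m \<Longrightarrow> Ak \<kappa> \<in> carrier_mat (N \<kappa>) (N \<kappa>)"
    and inter: "\<And>\<kappa>. \<kappa> < m \<Longrightarrow> T * U \<kappa> = U \<kappa> * mat_adjoint (Ak \<kappa>)"
    using data by (auto simp: gen_eigen_data_def T_def)
  have modal: "pair_connected q (N \<kappa>) k l (modal_inc q p (N \<kappa>) (U \<kappa>) (Ak \<kappa>) B) \<longleftrightarrow>
      (\<forall>z. ann (\<lambda>i a. \<Sum>j<N \<kappa>. cnj (U \<kappa> $$ (a,j)) * z i j) \<longrightarrow> (\<forall>j<N \<kappa>. z k j = z l j))"
    if \<kappa>: "\<kappa> < m" for \<kappa>
    unfolding modal_inc_connected_iff[OF rel kl U[OF \<kappa>] Ak[OF \<kappa>]] ann_def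
    by (subst ctrb_annihilator_modal[OF C U[OF \<kappa>] Ak[OF \<kappa>] inter[OF \<kappa>, unfolded T_def] Bc]) auto
  have whole: "pair_connected q n k l (array_ctrb q n p A B) \<longleftrightarrow> (\<forall>y. ann y \<longrightarrow> (\<forall>j<n. y k j = y l j))"
  proof -
    have cm: "ann y \<longleftrightarrow> ctrb_annihilator q n p A B (\<lambda>i j. Re (y i j)) \<and>
        ctrb_annihilator q n p A B (\<lambda>i j. Im (y i j))" for y
      unfolding ann_def by (rule ctrb_annihilator_cmat[OF A B])
    have "(\<forall>y :: nat \<Rightarrow> nat \<Rightarrow> real. ctrb_annihilator q n p A B y \<longrightarrow> (\<forall>j<n. y k j = y l j)) \<longleftrightarrow>
        (\<forall>y. ann y \<longrightarrow> (\<forall>j<n. y k j = y l j))"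
    proof safe
      fix y :: "nat \<Rightarrow> nat \<Rightarrow> complex" and j
      assume h: "\<forall>y :: nat \<Rightarrow> nat \<Rightarrow> real. ctrb_annihilator q n p A B y \<longrightarrow> (\<forall>j<n. y k j = y l j)" and "ann y" "j < n"
      hence "ctrb_annihilator q n p A B (\<lambda>i j. Re (y i j))" "ctrb_annihilator q n p A B (\<lambda>i j. Im (y i j))"
        by (simp_all add: cm)
      hence "Re (y k j) = Re (y l j)" "Im (y k j) = Im (y l j)"
        using h[rule_format, of "\<lambda>i j. Re (y i j)" j] h[rule_format, of "\<lambda>i j. Im (y i j)" j] \<open>j < n\<close>
        by simp_all
      thus "y k j = y l j" by (simp add: complex_eq_iff)
    next
      fix y :: "nat \<Rightarrow> nat \<Rightarrow> real" and j
      assume h: "\<forall>y. ann y \<longrightarrow> (\<forall>j<n. y k j = y l j)" and "ctrb_annihilator q n p A B y" "j < n"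
      hence "ann (\<lambda>i j. complex_of_real (y i j))"
        unfolding cm by (simp add: ctrb_annihilator_def)
      with h \<open>j < n\<close> show "y k j = y l j" by fastforce
    qed
    thus ?thesis unfolding array_ctrb_connected_iff[OF rel kl] .
  qed
  show ?thesis
  proof
    assume "pair_connected q n k l (array_ctrb q n p A B)"
    hence conn: "\<And>y j. ann y \<Longrightarrow> j < n \<Longrightarrow> y k j = y l j" by (simp add: whole)
    show "\<forall>\<kappa><m. pair_connected q (N \<kappa>) k l (modal_inc q p (N \<kappa>) (U \<kappa>) (Ak \<kappa>) B)"
    proof (intro allI impI, unfold modal, intro allI impI)
      fix \<kappa> z j assume \<kappa>: "\<kappa> < m" and z: "ann (\<lambda>i a. \<Sum>j<N \<kappa>. cnj (U \<kappa> $$ (a,j)) * z i j)" and j: "j < N \<kappa>"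
      define v where "v = vec (N \<kappa>) (\<lambda>j. cnj (z k j - z l j))"
      have v: "v \<in> carrier_vec (N \<kappa>)" by (simp add: v_def)
      have "U \<kappa> *\<^sub>v v = 0\<^sub>v n"
      proof (rule eq_vecI)
        fix a assume "a < dim_vec (0\<^sub>v n :: complex vec)"
        hence a: "a < n" by simp
        have "(U \<kappa> *\<^sub>v v) $ a = cnj ((\<Sum>j<N \<kappa>. cnj (U \<kappa> $$ (a,j)) * z k j) - (\<Sum>j<N \<kappa>. cnj (U \<kappa> $$ (a,j)) * z l j))"
          unfolding mult_mat_vec_nth[OF U[OF \<kappa>] v a] by (simp add: v_def right_diff_distrib sum_subtractf)
        also have "\<dots> = 0" using conn[OF z a] by simp
        finally show "(U \<kappa> *\<^sub>v v) $ a = 0\<^sub>v n $ a" using a by simp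
      qed (use U[OF \<kappa>] in simp)
      hence "v = 0\<^sub>v (N \<kappa>)" by (rule full_rank_injective[OF U[OF \<kappa>] rank[OF \<kappa>] v])
      hence "v $ j = 0" using j by simp
      thus "z k j = z l j" using j by (simp add: v_def)
    qed
  next
    assume "\<forall>\<kappa><m. pair_connected q (N \<kappa>) k l (modal_inc q p (N \<kappa>) (U \<kappa>) (Ak \<kappa>) B)"
    hence conn: "\<And>\<kappa> z j. \<kappa> < m \<Longrightarrow> ann (\<lambda>i a. \<Sum>j<N \<kappa>. cnj (U \<kappa> $$ (a,j)) * z i j) \<Longrightarrow> j < N \<kappa> \<Longrightarrow> z k j = z l j"
      by (simp add: modal)
    obtain as where as: "char_poly T = (\<Prod>a\<leftarrow>as. [:- a, 1:])"
      using char_poly_factorized[OF T] by blast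
    define S where "S = {c :: nat \<Rightarrow> complex vec. (\<forall>i. c i \<in> carrier_vec n) \<and> ann (\<lambda>i j. c i $ j)}"
    have ann_cong: "ann y \<longleftrightarrow> ann y'" if "\<And>i j. j < n \<Longrightarrow> y i j = y' i j" for y y'
      using that by (simp add: ann_def ctrb_annihilator_def)
    have inv: "(\<lambda>i. (T - a \<cdot>\<^sub>m 1\<^sub>m n) *\<^sub>v c i) \<in> S" if c: "c \<in> S" for c a
    proof -
      have ci: "c i \<in> carrier_vec n" for i using c by (simp add: S_def)
      have "ann (\<lambda>i j. (\<Sum>b<n. cmat A $$ (b,j) * c i $ b) - a * c i $ j)"
        unfolding ann_def
        by (rule ctrb_annihilator_step[OF C Bc]) (use c in \<open>auto simp: S_def ann_def\<close>)
      also have "?this \<longleftrightarrow> ann (\<lambda>i j. ((T - a \<cdot>\<^sub>m 1\<^sub>m n) *\<^sub>v c i) $ j)"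
        by (rule ann_cong) (simp add: minus_smult_one_mult_vec[OF T ci] Ti del: index_mult_mat_vec index_map_mat)
      finally show ?thesis using T ci by (auto simp: S_def intro!: mult_mat_vec_carrier[of _ n n])
    qed
    have eig: "c k = c l"
      if c: "c \<in> S" and e: "e \<le> Polynomial.order a (char_poly T)"
        and ker: "\<And>i. (T - a \<cdot>\<^sub>m 1\<^sub>m n) ^\<^sub>m e *\<^sub>v c i = 0\<^sub>v n" for c a e
    \<comment> \<open>for \<open>e = 0\<close> the number \<open>a\<close> need not be an eigenvalue\<close>
    proof (cases "e = 0")
      case True
      have ci: "c i \<in> carrier_vec n" for i using c by (simp add: S_def)
      have "c i = 0\<^sub>v n" for i using ker[of i] ci[of i] T True by simp
      thus ?thesis by simp
    next
      case False
      have ci: "c i \<in> carrier_vec n" for i using c by (simp add: S_def)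
      have nz: "char_poly T \<noteq> 0" using degree_monic_char_poly[OF T] by auto
      have "poly (char_poly T) a = 0" using False e nz by (simp add: order_root)
      hence "a \<in> spectrum T" by (simp add: spectrum_def eigenvalue_root_char_poly[OF T])
      hence "a \<in> \<mu> ` {..<m}" using bij unfolding bij_betw_def by simp
      then obtain \<kappa> where \<kappa>: "\<kappa> < m" "\<mu> \<kappa> = a" by auto
      let ?M = "T - a \<cdot>\<^sub>m 1\<^sub>m n"
      have M: "?M \<in> carrier_mat n n" using T by auto
      obtain f where f: "N \<kappa> = f + e" using e N[OF \<kappa>(1)] \<kappa>(2) by (metis le_add_diff_inverse2)
      have "c i \<in> mat_kernel (?M ^\<^sub>m N \<kappa>)" for i
      proof (rule mat_kernelI[OF pow_carrier_mat[OF M] ci])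
        have "?M ^\<^sub>m N \<kappa> *\<^sub>v c i = ?M ^\<^sub>m f *\<^sub>v (?M ^\<^sub>m e *\<^sub>v c i)"
          unfolding f pow_mat_add[OF M] by (rule assoc_mult_mat_vec[OF pow_carrier_mat[OF M] pow_carrier_mat[OF M] ci])
        thus "?M ^\<^sub>m N \<kappa> *\<^sub>v c i = 0\<^sub>v n"
          unfolding ker using mult_mat_vec_nth[OF pow_carrier_mat[OF M], of "0\<^sub>v n" _ f] M by (intro eq_vecI) auto
      qed
      hence "c i \<in> vec_space.col_space n (U \<kappa>)" for i using range[OF \<kappa>(1)] \<kappa>(2) by simp
      hence "\<exists>w. w \<in> carrier_vec (N \<kappa>) \<and> c i = U \<kappa> *\<^sub>v w" for i
        unfolding vec_space.col_space_eq[OF U[OF \<kappa>(1)]] using U[OF \<kappa>(1)] by simp metis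
      then obtain w where w: "\<And>i. w i \<in> carrier_vec (N \<kappa>)" "\<And>i. c i = U \<kappa> *\<^sub>v w i" by metis
      have "ann (\<lambda>i j. cnj (c i $ j))"
        unfolding ann_def by (rule ctrb_annihilator_cnj[OF A B]) (use c in \<open>auto simp: S_def ann_def\<close>)
      also have "?this \<longleftrightarrow> ann (\<lambda>i a. \<Sum>j<N \<kappa>. cnj (U \<kappa> $$ (a,j)) * cnj (w i $ j))"
        by (rule ann_cong) (simp add: w(2) mult_mat_vec_nth[OF U[OF \<kappa>(1)] w(1)] del: index_mult_mat_vec)
      finally have "cnj (w k $ j) = cnj (w l $ j)" if "j < N \<kappa>" for j
        using conn[OF \<kappa>(1), of "\<lambda>i j. cnj (w i $ j)"] that by blast
      hence "w k = w l" using w(1)[of k] w(1)[of l] by (intro eq_vecI) auto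
      thus ?thesis by (simp add: w(2))
    qed
    show "pair_connected q n k l (array_ctrb q n p A B)"
      unfolding whole
    proof (intro allI impI)
      fix y j assume y: "ann y" and j: "j < n"
      define c where "c i = vec n (y i)" for i
      have cS: "c \<in> S" using y by (simp add: S_def c_def cong: ann_cong)
      have "c k = c l"
      proof (rule blocks_agree_by_eigenspaces[of T n S "\<lambda>x. Polynomial.order x (char_poly T)"])
        show "linear_factors_mat T as *\<^sub>v c i = 0\<^sub>v n" for i
        proof -
          have "linear_factors_mat T as = 0\<^sub>m n n"
            using cayley_hamilton[OF T] by (simp add: as mat_poly_linear_factors[OF T])
          thus ?thesis by (intro eq_vecI) (auto simp: c_def scalar_prod_def)
        qed
        show "count_list as x \<le> Polynomial.order x (char_poly T)" for x
          unfolding as by (rule count_list_le_order)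
      qed (use T inv eig cS in \<open>auto simp: S_def\<close>)
      hence "c k $ j = c l $ j" by simp
      thus "y k j = y l j" using j by (simp add: c_def)
    qed
  qed
qed

section \<open>Controllability implies connectedness\<close>

text \<open>
  Uniqueness for analytic functions in the form needed here: the geometric bound on the derivatives
  makes the Taylor remainder \<open>C (K |z - w|)\<^sup>m / m!\<close> tend to zero. The base point \<open>w\<close> may lie on either
  side of \<open>z\<close>, so the lemma can be used backwards in time.
\<close>

lemma derivative_chain_vanishes:
  fixes f :: "nat \<Rightarrow> real \<Rightarrow> real"
  assumes der: "\<And>r t. t \<in> {a..b} \<Longrightarrow> (f r has_field_derivative f (Suc r) t) (at t within {a..b})"
    and bound: "\<And>r t. t \<in> {a..b} \<Longrightarrow> \<bar>f r t\<bar> \<le> C * K ^ r"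
    and wz: "w \<in> {a..b}" "z \<in> {a..b}" and zero: "\<And>r. f r w = 0"
  shows "f 0 z = 0"
proof -
  have le: "\<bar>f 0 z\<bar> \<le> (C * K * \<bar>z - w\<bar>) * (inverse (fact m) * (K * \<bar>z - w\<bar>) ^ m)" for m
  proof -
    have "\<bar>f 0 z\<bar> \<le> C * K ^ Suc m * \<bar>z - w\<bar> ^ Suc m / fact m"
      using field_Taylor[of "{a..b}" m f "C * K ^ Suc m" w z] der bound[of _ "Suc m"] wz zero by simp
    thus ?thesis by (simp add: divide_inverse power_mult_distrib mult_ac)
  qed
  have "(\<lambda>m. (C * K * \<bar>z - w\<bar>) * (inverse (fact m) * (K * \<bar>z - w\<bar>) ^ m)) \<longlonglongrightarrow> C * K * \<bar>z - w\<bar> * 0"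
    by (intro tendsto_mult_left summable_LIMSEQ_zero summable_exp)
  hence "\<bar>f 0 z\<bar> \<le> C * K * \<bar>z - w\<bar> * 0"
    using le by (intro LIMSEQ_le_const) auto
  thus ?thesis by simp
qed

lemma pow_mat_entry_bound:
  fixes A :: "real mat"
  assumes A: "A \<in> carrier_mat n n"
  obtains K where "K \<ge> 0" "\<And>r i j. i < n \<Longrightarrow> j < n \<Longrightarrow> \<bar>(A ^\<^sub>m r) $$ (i,j)\<bar> \<le> K ^ r"
proof
  define K where "K = (\<Sum>i<n. \<Sum>j<n. \<bar>A $$ (i,j)\<bar>)"
  show K0: "K \<ge> 0" unfolding K_def by (intro sum_nonneg) auto
  fix r i j assume ij: "i < n" "j < n"
  show "\<bar>(A ^\<^sub>m r) $$ (i,j)\<bar> \<le> K ^ r"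
    using ij
  proof (induction r arbitrary: j)
    case 0
    thus ?case using A by simp
  next
    case (Suc r)
    have "(\<Sum>s<n. \<bar>A $$ (s,j)\<bar>) \<le> (\<Sum>s<n. \<Sum>j<n. \<bar>A $$ (s,j)\<bar>)"
      using Suc.prems(2) by (intro sum_mono member_le_sum) auto
    hence col: "(\<Sum>s<n. \<bar>A $$ (s,j)\<bar>) \<le> K" by (simp add: K_def)
    have "\<bar>(A ^\<^sub>m Suc r) $$ (i,j)\<bar> = \<bar>\<Sum>s<n. (A ^\<^sub>m r) $$ (i,s) * A $$ (s,j)\<bar>"
      using mult_mat_nth[OF pow_carrier_mat[OF A, of r] A Suc.prems] by simp
    also have "\<dots> \<le> (\<Sum>s<n. \<bar>(A ^\<^sub>m r) $$ (i,s)\<bar> * \<bar>A $$ (s,j)\<bar>)"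
      by (rule order_trans[OF sum_abs]) (simp add: abs_mult)
    also have "\<dots> \<le> (\<Sum>s<n. K ^ r * \<bar>A $$ (s,j)\<bar>)"
      using Suc by (intro sum_mono mult_right_mono) auto
    also have "\<dots> \<le> K ^ r * K"
      unfolding sum_distrib_left[symmetric] using col K0 by (intro mult_left_mono) auto
    finally show ?case by (simp add: mult.commute)
  qed
qed

text \<open>
  Consider the outputs \<open>f\<^sub>r(t) = \<Sum>\<^sub>i y\<^sub>i\<^sup>T A\<^sup>r x\<^sub>i(t)\<close>. Since \<open>y\<close> is an annihilator, the input drops out of
  the integral equation and \<open>f\<^sub>r\<close> has derivative \<open>f\<^sub>r\<^sub>+\<^sub>1\<close>, no matter how irregular the input is. The
  states are bounded and \<open>A\<^sup>r\<close> grows at most geometrically, so the values \<open>f\<^sub>r(w)\<close> at one time \<open>w\<close>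
  determine \<open>f\<^sub>0\<close>.
\<close>

lemma trajectory_annihilator_vanishes:
  fixes x :: "nat \<Rightarrow> real \<Rightarrow> real vec" and y :: "nat \<Rightarrow> nat \<Rightarrow> real"
  assumes A: "A \<in> carrier_mat n n" and B: "\<And>i \<sigma>. i < q \<Longrightarrow> \<sigma> < p \<Longrightarrow> B i \<sigma> \<in> carrier_mat n 1"
    and traj: "array_trajectory q n p A B \<tau> u x"
    and ann: "ctrb_annihilator q n p A B y"
    and wz: "w \<in> {0..\<tau>}" "z \<in> {0..\<tau>}"
    and zero: "\<And>r. (\<Sum>i<q. \<Sum>a<n. (\<Sum>j<n. y i j * (A ^\<^sub>m r) $$ (j,a)) * x i w $ a) = 0"
  shows "(\<Sum>i<q. \<Sum>a<n. y i a * x i z $ a) = 0"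
proof -
  define h where "h r i a = (\<Sum>j<n. y i j * (A ^\<^sub>m r) $$ (j,a))" for r i a
  define f where "f r t = (\<Sum>i<q. \<Sum>a<n. h r i a * x i t $ a)" for r t
  define g where "g i a s = (A *\<^sub>v x i s) $ a + (\<Sum>\<sigma><p. B i \<sigma> $$ (a,0) * u \<sigma> s)" for i a s
  have xc: "x i t \<in> carrier_vec n" if "i < q" "t \<in> {0..\<tau>}" for i t
    using traj that by (auto simp: array_trajectory_def)
  have xint: "(g i a has_integral x i t $ a - x i 0 $ a) {0..t}" if "i < q" "t \<in> {0..\<tau>}" "a < n" for i t a
    using traj that unfolding array_trajectory_def g_def by blast
  \<comment> \<open>transposed powers of \<open>A\<close> act on \<open>y\<close>; \<open>h r\<close> is the row vector \<open>y\<^sup>T A\<^sup>r\<close>\<close>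
  have hS: "(\<Sum>a<n. h r i a * A $$ (a,b)) = h (Suc r) i b" if b: "b < n" for r i b
  proof -
    have "(\<Sum>a<n. h r i a * A $$ (a,b)) = (\<Sum>j<n. y i j * (\<Sum>a<n. (A ^\<^sub>m r) $$ (j,a) * A $$ (a,b)))"
      unfolding h_def sum_distrib_left sum_distrib_right by (subst sum.swap) (simp add: mult.assoc)
    also have "\<dots> = h (Suc r) i b"
      unfolding h_def using mult_mat_nth[OF pow_carrier_mat[OF A, of r] A _ b] by (intro sum.cong refl) simp
    finally show ?thesis .
  qed
  have hB: "(\<Sum>i<q. \<Sum>a<n. h r i a * B i \<sigma> $$ (a,0)) = 0" if \<sigma>: "\<sigma> < p" for r \<sigma>
  proof -
    have "(\<Sum>i<q. \<Sum>a<n. h r i a * B i \<sigma> $$ (a,0)) =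
        (\<Sum>i<q. \<Sum>j<n. y i j * (\<Sum>a<n. (A ^\<^sub>m r) $$ (j,a) * B i \<sigma> $$ (a,0)))"
      unfolding h_def sum_distrib_left sum_distrib_right by (subst sum.swap) (simp add: mult.assoc)
    also have "\<dots> = (\<Sum>i<q. \<Sum>j<n. y i j * (A ^\<^sub>m r * B i \<sigma>) $$ (j,0))"
      by (intro sum.cong refl) (use mult_mat_nth[OF pow_carrier_mat[OF A, of r] B[OF _ \<sigma>]] in simp)
    also have "\<dots> = 0" using ann \<sigma> by (simp add: ctrb_annihilator_def)
    finally show ?thesis .
  qed
  have hg: "(\<Sum>i<q. \<Sum>a<n. h r i a * g i a s) = f (Suc r) s" if s: "s \<in> {0..\<tau>}" for r s
  proof -
    have "(\<Sum>a<n. h r i a * (A *\<^sub>v x i s) $ a) = (\<Sum>b<n. h (Suc r) i b * x i s $ b)" if i: "i < q" for i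
    proof -
      have "(\<Sum>a<n. h r i a * (A *\<^sub>v x i s) $ a) = (\<Sum>a<n. \<Sum>b<n. h r i a * A $$ (a,b) * x i s $ b)"
        by (intro sum.cong refl) (simp add: mult_mat_vec_nth[OF A xc[OF i s]] sum_distrib_left mult.assoc del: index_mult_mat_vec)
      also have "\<dots> = (\<Sum>b<n. (\<Sum>a<n. h r i a * A $$ (a,b)) * x i s $ b)"
        by (subst sum.swap) (simp add: sum_distrib_right)
      finally show ?thesis by (simp add: hS)
    qed
    moreover have "(\<Sum>i<q. \<Sum>a<n. h r i a * (\<Sum>\<sigma><p. B i \<sigma> $$ (a,0) * u \<sigma> s)) = 0"
    proof -
      have "(\<Sum>i<q. \<Sum>a<n. h r i a * (\<Sum>\<sigma><p. B i \<sigma> $$ (a,0) * u \<sigma> s)) =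
          (\<Sum>i<q. \<Sum>\<sigma><p. (\<Sum>a<n. h r i a * B i \<sigma> $$ (a,0)) * u \<sigma> s)"
        unfolding sum_distrib_left sum_distrib_right
        by (rule sum.cong[OF refl], subst sum.swap) (simp add: mult.assoc)
      also have "\<dots> = (\<Sum>\<sigma><p. (\<Sum>i<q. \<Sum>a<n. h r i a * B i \<sigma> $$ (a,0)) * u \<sigma> s)"
        by (subst sum.swap) (simp add: sum_distrib_right)
      finally show ?thesis by (simp add: hB)
    qed
    ultimately show ?thesis
      by (simp add: g_def f_def distrib_left sum.distrib del: index_mult_mat_vec)
  qed
  have fint: "(f (Suc r) has_integral f r t - f r 0) {0..t}" if t: "t \<in> {0..\<tau>}" for r t
  proof -
    have "((\<lambda>s. \<Sum>i<q. \<Sum>a<n. h r i a * g i a s) has_integral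
        (\<Sum>i<q. \<Sum>a<n. h r i a * (x i t $ a - x i 0 $ a))) {0..t}"
      by (intro has_integral_sum has_integral_mult_right xint t) auto
    moreover have "(\<Sum>i<q. \<Sum>a<n. h r i a * (x i t $ a - x i 0 $ a)) = f r t - f r 0"
      by (simp add: f_def right_diff_distrib sum_subtractf)
    ultimately have "((\<lambda>s. \<Sum>i<q. \<Sum>a<n. h r i a * g i a s) has_integral f r t - f r 0) {0..t}" by simp
    thus ?thesis by (rule has_integral_eq[rotated]) (use hg t in auto)
  qed
  have \<tau>: "0 \<le> \<tau>" using wz by simp
  have f_eq: "f r t = f r 0 + integral {0..t} (f (Suc r))" if "t \<in> {0..\<tau>}" for r t
    unfolding integral_unique[OF fint[OF that]] by simp
  have cont: "continuous_on {0..\<tau>} (f r)" for r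
  proof -
    have "f (Suc r) integrable_on {0..\<tau>}" using fint[of \<tau> r] \<tau> by (auto simp: integrable_on_def)
    hence "continuous_on {0..\<tau>} (\<lambda>t. f r 0 + integral {0..t} (f (Suc r)))"
      by (intro continuous_intros indefinite_integral_continuous_1)
    thus ?thesis by (rule continuous_on_eq) (rule f_eq[symmetric])
  qed
  have der: "(f r has_field_derivative f (Suc r) t) (at t within {0..\<tau>})" if t: "t \<in> {0..\<tau>}" for r t
  proof -
    have "((\<lambda>t. f r 0 + integral {0..t} (f (Suc r))) has_field_derivative 0 + f (Suc r) t) (at t within {0..\<tau>})"
      by (intro DERIV_add DERIV_const integral_has_real_derivative[OF cont t])
    thus ?thesis
      by (auto intro!: has_field_derivative_transform_within[of _ "f (Suc r) t" t "{0..\<tau>}" 1 "f r"] t f_eq[symmetric])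
  qed
  have xbd: "\<exists>M. \<forall>t\<in>{0..\<tau>}. \<bar>x i t $ a\<bar> \<le> M" if ia: "i < q" "a < n" for i a
  proof -
    have "g i a integrable_on {0..\<tau>}" using xint[OF ia(1) _ ia(2), of \<tau>] \<tau> by (auto simp: integrable_on_def)
    hence "continuous_on {0..\<tau>} (\<lambda>t. x i 0 $ a + integral {0..t} (g i a))"
      by (intro continuous_intros indefinite_integral_continuous_1)
    hence "continuous_on {0..\<tau>} (\<lambda>t. x i t $ a)"
      by (rule continuous_on_eq) (simp add: integral_unique[OF xint[OF ia(1) _ ia(2)]])
    hence "bounded ((\<lambda>t. x i t $ a) ` {0..\<tau>})"
      by (intro compact_imp_bounded compact_continuous_image) auto
    thus ?thesis by (auto simp: bounded_iff)
  qed
  obtain M where M: "\<And>i a t. i < q \<Longrightarrow> a < n \<Longrightarrow> t \<in> {0..\<tau>} \<Longrightarrow> \<bar>x i t $ a\<bar> \<le> M i a"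
    using xbd by metis
  obtain K where K: "K \<ge> 0" "\<And>r i j. i < n \<Longrightarrow> j < n \<Longrightarrow> \<bar>(A ^\<^sub>m r) $$ (i,j)\<bar> \<le> K ^ r"
    using pow_mat_entry_bound[OF A] by metis
  define Y where "Y i = sum (\<lambda>j. \<bar>y i j\<bar>) {..<n}" for i
  have bound: "\<bar>f r t\<bar> \<le> (\<Sum>i<q. \<Sum>a<n. Y i * M i a) * K ^ r" if t: "t \<in> {0..\<tau>}" for r t
  proof -
    have hb: "\<bar>h r i a\<bar> \<le> Y i * K ^ r" if "a < n" for i a
    proof -
      have "\<bar>h r i a\<bar> \<le> (\<Sum>j<n. \<bar>y i j\<bar> * \<bar>(A ^\<^sub>m r) $$ (j,a)\<bar>)"
        unfolding h_def by (rule order_trans[OF sum_abs]) (simp add: abs_mult)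
      also have "\<dots> \<le> (\<Sum>j<n. \<bar>y i j\<bar> * K ^ r)"
        using K(2) that by (intro sum_mono mult_left_mono) auto
      finally show ?thesis by (simp add: Y_def sum_distrib_right)
    qed
    have "\<bar>f r t\<bar> \<le> (\<Sum>i<q. \<Sum>a<n. \<bar>h r i a\<bar> * \<bar>x i t $ a\<bar>)"
      unfolding f_def by (intro order_trans[OF sum_abs] sum_mono) (simp add: abs_mult flip: abs_mult)
    also have "\<dots> \<le> (\<Sum>i<q. \<Sum>a<n. (Y i * K ^ r) * M i a)"
      using hb M[OF _ _ t] K(1) by (intro sum_mono mult_mono) (auto simp: Y_def intro!: mult_nonneg_nonneg sum_nonneg)
    also have "\<dots> = (\<Sum>i<q. \<Sum>a<n. Y i * M i a) * K ^ r"
      by (simp add: sum_distrib_left mult_ac)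
    finally show ?thesis .
  qed
  have "f 0 z = 0"
    by (rule derivative_chain_vanishes[of 0 \<tau> f, OF der bound wz]) (use zero in \<open>auto simp: f_def h_def\<close>)
  moreover have "h 0 i a = y i a" if "a < n" for i a
    using that A by (simp add: h_def if_distrib[of "\<lambda>x. _ * x"] cong: if_cong)
  ultimately show ?thesis by (simp add: f_def)
qed

text \<open>
  Start from \<open>e\<^sub>j\<close> at node \<open>k\<close>, from \<open>-e\<^sub>j\<close> at node \<open>l\<close>, and from zero elsewhere. The sum of all states
  evolves freely and starts at zero, so it stays zero; together with \<open>x\<^sub>k(\<tau>) = x\<^sub>l(\<tau>)\<close> and the free
  motion of the other nodes this forces every state to be zero at time \<open>\<tau>\<close>. Running the outputs of the
  annihilator \<open>y\<close> backwards from \<open>\<tau>\<close> shows that the initial output, which is \<open>y\<^sub>k\<^sub>j - y\<^sub>l\<^sub>j\<close>, vanishes.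
\<close>

theorem controllable_imp_annihilator_agrees:
  assumes rel: "array_rel_act q n p A B" and kl: "k < q" "l < q" "k \<noteq> l"
    and contr: "pair_controllable q n p k l A B"
    and ann: "ctrb_annihilator q n p A B y" and j: "j < n"
  shows "y k j = y l j"
proof -
  have A: "A \<in> carrier_mat n n" and B: "\<And>i \<sigma>. i < q \<Longrightarrow> \<sigma> < p \<Longrightarrow> B i \<sigma> \<in> carrier_mat n 1"
    and s: "\<And>\<sigma> j. \<sigma> < p \<Longrightarrow> j < n \<Longrightarrow> (\<Sum>i<q. B i \<sigma> $$ (j,0)) = 0"
    using rel by (auto simp: array_rel_act_def)
  define x0 :: "nat \<Rightarrow> real vec" where
    "x0 i = (if i = k then unit_vec n j else if i = l then - unit_vec n j else 0\<^sub>v n)" for i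
  have x0_sum: "(\<Sum>i<q. w i * x0 i $ a) = (w k - w l) * (if a = j then 1 else 0)" if "a < n" for w :: "nat \<Rightarrow> real" and a
  proof -
    have "w i * x0 i $ a = (if i = k then w i * (if a = j then 1 else 0) else 0)
        - (if i = l then w i * (if a = j then 1 else 0) else 0)" for i
      using that j kl(3) by (auto simp: x0_def unit_vec_def)
    thus ?thesis using kl by (simp add: sum_subtractf left_diff_distrib)
  qed
  have "\<forall>i<q. x0 i \<in> carrier_vec n" by (auto simp: x0_def)
  then obtain \<tau> u x where \<tau>: "\<tau> > 0" and traj: "array_trajectory q n p A B \<tau> u x"
    and init: "\<forall>i<q. x i 0 = x0 i" and meet: "x k \<tau> = x l \<tau>"
    and rest: "\<forall>i<q. i \<noteq> k \<longrightarrow> i \<noteq> l \<longrightarrow> x i \<tau> = mat_exp (\<tau> \<cdot>\<^sub>m A) *\<^sub>v x0 i"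
    using contr unfolding pair_controllable_def by blast
  have mid: "x i \<tau> $ a = 0" if "i < q" "i \<noteq> k" "i \<noteq> l" "a < n" for i a
    using rest that A by (auto simp: x0_def mat_exp_def scalar_prod_def)
  have total: "(\<Sum>i<q. x i \<tau> $ a) = 0" if a: "a < n" for a
  proof -
    \<comment> \<open>this annihilator has equal blocks; its output is the \<open>a\<close>-th component of the sum of all states\<close>
    define e :: "nat \<Rightarrow> nat \<Rightarrow> real" where "e i j = (if j = a then 1 else 0)" for i j
    have es: "(\<Sum>j<n. e i j * v j) = v a" for i and v :: "nat \<Rightarrow> real"
      using a by (simp add: e_def if_distrib[of "\<lambda>x. x * _"] cong: if_cong)
    have ann_e: "ctrb_annihilator q n p A B e"
      unfolding ctrb_annihilator_def es
      using relative_actuation_mult[OF pow_carrier_mat[OF A] B s a] by simp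
    have start: "(\<Sum>i<q. \<Sum>b<n. (\<Sum>j<n. e i j * (A ^\<^sub>m r) $$ (j,b)) * x i 0 $ b) = 0" for r
    proof -
      have "(\<Sum>i<q. \<Sum>b<n. (\<Sum>j<n. e i j * (A ^\<^sub>m r) $$ (j,b)) * x i 0 $ b) =
          (\<Sum>b<n. \<Sum>i<q. (A ^\<^sub>m r) $$ (a,b) * x0 i $ b)"
        unfolding es by (subst sum.swap) (simp add: init)
      also have "\<dots> = 0" by (simp add: x0_sum)
      finally show ?thesis .
    qed
    have "(\<Sum>i<q. \<Sum>b<n. e i b * x i \<tau> $ b) = 0"
      by (rule trajectory_annihilator_vanishes[OF A B traj ann_e _ _ start]) (use \<tau> in auto)
    thus ?thesis by (simp add: es)
  qed
  have end0: "x i \<tau> $ a = 0" if i: "i < q" and a: "a < n" for i a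
  proof -
    have "(\<Sum>i<q. x i \<tau> $ a) = (\<Sum>i\<in>{k,l}. x i \<tau> $ a)"
      using kl mid a by (intro sum.mono_neutral_right) auto
    hence "x k \<tau> $ a = 0" "x l \<tau> $ a = 0" using total[OF a] kl(3) meet by auto
    thus ?thesis using mid[OF i _ _ a] by (cases "i = k"; cases "i = l") auto
  qed
  have "(\<Sum>i<q. \<Sum>a<n. y i a * x i 0 $ a) = 0"
    by (rule trajectory_annihilator_vanishes[OF A B traj ann, where w = \<tau>]) (use \<tau> in \<open>auto simp: end0\<close>)
  hence "(\<Sum>a<n. \<Sum>i<q. y i a * x0 i $ a) = 0" by (subst sum.swap) (simp add: init)
  hence "(\<Sum>a<n. (y k a - y l a) * (if a = j then 1 else 0)) = 0" by (simp add: x0_sum)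
  thus ?thesis using j by (simp add: if_distrib[of "\<lambda>x. _ * x"] cong: if_cong)
qed

section \<open>Steering with polynomial inputs\<close>

text \<open>
  The derivative of \<open>(x - a)\<^sup>m\<^sup>+\<^sup>1 g\<close> is again a power \<open>(x - a)\<^sup>m\<close> times a polynomial, whose value at \<open>a\<close>
  is \<open>(m + 1) g(a)\<close>.
\<close>

lemma poly_pderiv_power_at_root:
  fixes g :: "'a::field_char_0 poly"
  shows "poly ((pderiv ^^ m) ([:- a, 1:] ^ m * g)) a = fact m * poly g a"
proof (induction m arbitrary: g)
  case (Suc m)
  have "pderiv ([:- a, 1:] ^ Suc m * g) =
      [:- a, 1:] ^ m * (Polynomial.smult (of_nat (Suc m)) g + [:- a, 1:] * pderiv g)"
    by (simp only: pderiv_mult pderiv_power_Suc) (simp add: pderiv_pCons algebra_simps)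
  thus ?case
    by (simp only: funpow_Suc_right o_apply Suc) (simp add: algebra_simps)
qed simp

lemma poly_pderiv_power_below:
  fixes g :: "'a::field_char_0 poly"
  assumes "i < m"
  shows "poly ((pderiv ^^ i) ([:- a, 1:] ^ m * g)) a = 0"
proof -
  have "[:- a, 1:] ^ m * g = [:- a, 1:] ^ i * ([:- a, 1:] ^ (m - i) * g)"
    using assms by (simp add: mult.assoc[symmetric] power_add[symmetric])
  thus ?thesis using assms by (simp only: poly_pderiv_power_at_root) (simp add: poly_power)
qed

lemma higher_pderiv_add:
  "(pderiv ^^ i) (p + q) = (pderiv ^^ i) p + (pderiv ^^ i) (q :: 'a::field_char_0 poly)"
  by (induction i) (simp_all add: pderiv_add)

lemma higher_pderiv_smult:
  "(pderiv ^^ i) (Polynomial.smult c p) = Polynomial.smult c ((pderiv ^^ i) (p :: 'a::field_char_0 poly))"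
  by (induction i) (simp_all add: pderiv_smult)

text \<open>
  Polynomials that are flat to order \<open>n\<close> at 0 can have any prescribed jet at 1; the unitriangular
  matrix \<open>b\<close> merely changes coordinates on jets, and including it here avoids inverting it. The
  correction in the induction step is a multiple of \<open>(x - 1)\<^sup>m x\<^sup>n\<close>, which leaves the derivatives of
  order less than \<open>m\<close> at 1 unchanged.
\<close>

lemma triangular_hermite_interpolation:
  fixes b :: "nat \<Rightarrow> nat \<Rightarrow> 'a::field_char_0"
  assumes "\<And>j. b j j = 1"
  shows "\<exists>\<psi>. [:0, 1:] ^ n dvd \<psi> \<and> (\<forall>j<m. (\<Sum>s\<le>j. b j s * poly ((pderiv ^^ s) \<psi>) 1) = \<alpha> j)"
proof (induction m)
  case (Suc m)
  then obtain \<psi> where d: "[:0, 1:] ^ n dvd \<psi>" and \<psi>: "\<And>j. j < m \<Longrightarrow> (\<Sum>s\<le>j. b j s * poly ((pderiv ^^ s) \<psi>) 1) = \<alpha> j"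
    by blast
  define \<rho> :: "'a poly" where "\<rho> = [:- 1, 1:] ^ m * [:0, 1:] ^ n"
  define c where "c = (\<alpha> m - (\<Sum>s\<le>m. b m s * poly ((pderiv ^^ s) \<psi>) 1)) / fact m"
  have low: "poly ((pderiv ^^ s) \<rho>) 1 = 0" if "s < m" for s
    unfolding \<rho>_def by (rule poly_pderiv_power_below[OF that])
  have top: "poly ((pderiv ^^ m) \<rho>) 1 = fact m"
    unfolding \<rho>_def poly_pderiv_power_at_root by simp
  have L: "(\<Sum>s\<le>j. b j s * poly ((pderiv ^^ s) (\<psi> + Polynomial.smult c \<rho>)) 1) =
      (\<Sum>s\<le>j. b j s * poly ((pderiv ^^ s) \<psi>) 1) + c * (\<Sum>s\<le>j. b j s * poly ((pderiv ^^ s) \<rho>) 1)" for j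
    by (simp add: higher_pderiv_add higher_pderiv_smult distrib_left sum.distrib sum_distrib_left mult.left_commute)
  have "(\<Sum>s\<le>m. b m s * poly ((pderiv ^^ s) \<rho>) 1) = fact m"
    by (simp add: lessThan_Suc_atMost[symmetric] low top assms)
  hence "(\<Sum>s\<le>j. b j s * poly ((pderiv ^^ s) (\<psi> + Polynomial.smult c \<rho>)) 1) = \<alpha> j" if "j < Suc m" for j
    unfolding L using that \<psi>[of j] by (cases "j = m") (simp_all add: c_def low)
  moreover have "[:0, 1:] ^ n dvd \<psi> + Polynomial.smult c \<rho>"
    using d by (intro dvd_add dvd_smult) (simp_all add: \<rho>_def)
  ultimately show ?case by blast
qed auto

text \<open>
  Polynomial steering of a single-input system in controllable companion form, from the origin at time
  0 to \<open>\<alpha>\<close> at time 1. With state \<open>z = \<Sum>\<^sub>r \<phi>\<^sub>r v\<^sub>r\<close>, where \<open>v\<^sub>r = A\<^sup>r b\<close>, the displayed identity is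
  \<open>z' = A z + u b\<close>; only the recurrence satisfied by \<open>v\<close> enters, so it can be stated componentwise for
  real sequences. Following the flatness method, the last coordinate \<open>\<psi>\<close> is chosen first and the
  equations \<open>\<phi>\<^sub>r' = \<phi>\<^sub>r\<^sub>-\<^sub>1 - a\<^sub>r \<psi>\<close> determine the others by differentiation; the input is
  \<open>u = \<chi>(d/dt) \<psi>\<close> with \<open>\<chi> = \<Sum>\<^sub>r a\<^sub>r x\<^sup>r\<close>.
\<close>

lemma companion_steering:
  fixes a \<alpha> :: "nat \<Rightarrow> real"
  assumes n: "n \<ge> 1" and a: "a n = 1"
  obtains \<phi> :: "nat \<Rightarrow> real poly" and u :: "real poly"
  where "\<And>r. r < n \<Longrightarrow> poly (\<phi> r) 0 = 0" "\<And>r. r < n \<Longrightarrow> poly (\<phi> r) 1 = \<alpha> r"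
    "\<And>v t. (\<Sum>r\<le>n. a r * v r) = 0 \<Longrightarrow>
      (\<Sum>r<n. poly (pderiv (\<phi> r)) t * v r) = (\<Sum>r<n. poly (\<phi> r) t * v (Suc r)) + poly u t * v 0"
proof -
  \<comment> \<open>the case distinction only makes the diagonal equal to 1 for all \<open>j\<close>; for \<open>j \<le> n\<close> it agrees with \<open>a n = 1\<close>\<close>
  define b where "b j s = (if s = j then 1 else a (n - j + s))" for j s
  obtain \<psi> where d: "[:0, 1:] ^ n dvd \<psi>"
    and \<psi>: "\<And>j. j < n \<Longrightarrow> (\<Sum>s\<le>j. b j s * poly ((pderiv ^^ s) \<psi>) 1) = \<alpha> (n - 1 - j)"
    using triangular_hermite_interpolation[of b n n "\<lambda>j. \<alpha> (n - 1 - j)"] by (auto simp: b_def)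
  \<comment> \<open>\<open>\<theta> j\<close> is the coordinate \<open>\<phi> (n - 1 - j)\<close>, a combination of the derivatives of \<open>\<psi>\<close> up to order \<open>j\<close>, and \<open>\<theta> n\<close> is the input\<close>
  define \<theta> where "\<theta> j = (\<Sum>s\<le>j. Polynomial.smult (b j s) ((pderiv ^^ s) \<psi>))" for j
  have p\<theta>: "poly (\<theta> j) t = (\<Sum>s\<le>j. b j s * poly ((pderiv ^^ s) \<psi>) t)" for j t
    by (simp add: \<theta>_def poly_sum)
  have \<theta>0: "\<theta> 0 = \<psi>" by (simp add: \<theta>_def b_def)
  have \<theta>_Suc: "pderiv (\<theta> j) = \<theta> (Suc j) - Polynomial.smult (a (n - Suc j)) \<psi>" if j: "j < n" for j
  proof -
    have b: "b (Suc j) (Suc s) = b j s" if "s \<le> j" for s using that j by (auto simp: b_def intro!: arg_cong[of _ _ a])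
    have "\<theta> (Suc j) = Polynomial.smult (b (Suc j) 0) \<psi> + (\<Sum>s\<le>j. Polynomial.smult (b (Suc j) (Suc s)) ((pderiv ^^ Suc s) \<psi>))"
      unfolding \<theta>_def by (subst sum.atMost_Suc_shift) simp
    also have "(\<Sum>s\<le>j. Polynomial.smult (b (Suc j) (Suc s)) ((pderiv ^^ Suc s) \<psi>)) = pderiv (\<theta> j)"
      unfolding \<theta>_def by (simp add: b pderiv_sum pderiv_smult)
    finally show ?thesis by (simp add: b_def)
  qed
  obtain g where g: "\<psi> = [:- 0, 1:] ^ n * g" using d by (auto elim: dvdE)
  have "poly ((pderiv ^^ s) \<psi>) 0 = 0" if "s < n" for s
    unfolding g by (rule poly_pderiv_power_below[OF that])
  hence zero: "poly (\<theta> j) 0 = 0" if "j < n" for j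
    using that by (simp add: p\<theta>)
  define \<phi> where "\<phi> r = \<theta> (n - 1 - r)" for r
  define u where "u = \<theta> n"
  show ?thesis
  proof (rule that)
    fix r assume r: "r < n"
    show "poly (\<phi> r) 0 = 0" using r n zero by (simp add: \<phi>_def)
    show "poly (\<phi> r) 1 = \<alpha> r" using r n \<psi>[of "n - 1 - r"] by (simp add: \<phi>_def p\<theta>)
  next
    fix v :: "nat \<Rightarrow> real" and t
    assume rec: "(\<Sum>r\<le>n. a r * v r) = 0"
    hence vn: "(\<Sum>r<n. a r * v r) = - v n" by (simp add: lessThan_Suc_atMost[symmetric] a)
    have flip: "(\<Sum>r<n. f (n - Suc r)) = (\<Sum>r<n. f r)" for f :: "nat \<Rightarrow> real"
      by (rule sum.nat_diff_reindex)
    have "(\<Sum>r<n. poly (pderiv (\<phi> r)) t * v r) = (\<Sum>j<n. poly (pderiv (\<theta> j)) t * v (n - Suc j))"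
      using flip[of "\<lambda>j. poly (pderiv (\<theta> j)) t * v (n - Suc j)"] by (simp add: \<phi>_def)
    also have "\<dots> = (\<Sum>j<n. poly (\<theta> (Suc j)) t * v (n - Suc j)) - poly \<psi> t * (\<Sum>j<n. a (n - Suc j) * v (n - Suc j))"
      by (simp add: \<theta>_Suc algebra_simps sum_subtractf sum_distrib_left)
    also have "(\<Sum>j<n. a (n - Suc j) * v (n - Suc j)) = - v n"
      using flip[of "\<lambda>r. a r * v r"] vn by simp
    also have "(\<Sum>j<n. poly (\<theta> (Suc j)) t * v (n - Suc j)) =
        (\<Sum>j<n. poly (\<theta> j) t * v (n - j)) + poly u t * v 0 - poly \<psi> t * v n"
    proof -
      have "(\<Sum>j<Suc n. poly (\<theta> j) t * v (n - j)) = poly \<psi> t * v n + (\<Sum>j<n. poly (\<theta> (Suc j)) t * v (n - Suc j))"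
        by (subst sum.lessThan_Suc_shift) (simp add: \<theta>0)
      thus ?thesis by (simp add: u_def)
    qed
    also have "(\<Sum>j<n. poly (\<theta> j) t * v (n - j)) = (\<Sum>r<n. poly (\<phi> r) t * v (Suc r))"
      using flip[of "\<lambda>j. poly (\<theta> j) t * v (n - j)"] by (simp add: \<phi>_def Suc_diff_Suc)
    finally show "(\<Sum>r<n. poly (pderiv (\<phi> r)) t * v r) = (\<Sum>r<n. poly (\<phi> r) t * v (Suc r)) + poly u t * v 0"
      by simp
  qed
qed

section \<open>The matrix exponential\<close>

lemma smult_pow_mat_index:
  fixes A :: "'a::comm_ring_1 mat"
  assumes A: "A \<in> carrier_mat n n" and "i < n" "j < n"
  shows "((t \<cdot>\<^sub>m A) ^\<^sub>m r) $$ (i,j) = t ^ r * (A ^\<^sub>m r) $$ (i,j)"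
  using assms(3)
proof (induction r arbitrary: j)
  case (Suc r)
  have tA: "t \<cdot>\<^sub>m A \<in> carrier_mat n n" using A by simp
  have "((t \<cdot>\<^sub>m A) ^\<^sub>m Suc r) $$ (i,j) = (\<Sum>s<n. ((t \<cdot>\<^sub>m A) ^\<^sub>m r) $$ (i,s) * (t \<cdot>\<^sub>m A) $$ (s,j))"
    using mult_mat_nth[OF pow_carrier_mat[OF tA, of r] tA assms(2) Suc.prems] by simp
  also have "\<dots> = (\<Sum>s<n. t ^ Suc r * ((A ^\<^sub>m r) $$ (i,s) * A $$ (s,j)))"
    using Suc A by (intro sum.cong refl) simp
  also have "\<dots> = t ^ Suc r * (A ^\<^sub>m Suc r) $$ (i,j)"
    using mult_mat_nth[OF pow_carrier_mat[OF A, of r] A assms(2) Suc.prems] by (simp add: sum_distrib_left)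
  finally show ?case .
qed (use assms in simp)

lemma mat_exp_at_0:
  assumes A: "A \<in> carrier_mat n n" and "i < n" "j < n"
  shows "mat_exp (0 \<cdot>\<^sub>m A) $$ (i,j) = (if i = j then 1 else 0)"
proof -
  have "mat_exp (0 \<cdot>\<^sub>m A) $$ (i,j) = (\<Sum>r. (0 ^ r * (A ^\<^sub>m r) $$ (i,j)) / fact r)"
    using assms by (simp add: mat_exp_def smult_pow_mat_index[OF A])
  also have "\<dots> = (\<Sum>r. (A ^\<^sub>m r) $$ (i,j) / fact r * 0 ^ r)" by (simp add: mult.commute)
  also have "\<dots> = (A ^\<^sub>m 0) $$ (i,j) / fact 0" by (rule powser_zero)
  finally show ?thesis using assms by simp
qed

lemma mat_exp_deriv:
  assumes A: "A \<in> carrier_mat n n" and i: "i < n" and j: "j < n"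
  shows "((\<lambda>t. mat_exp (t \<cdot>\<^sub>m A) $$ (i,j)) has_field_derivative
    (\<Sum>s<n. A $$ (i,s) * mat_exp (t \<cdot>\<^sub>m A) $$ (s,j))) (at t)"
proof -
  define c where "c i r = (A ^\<^sub>m r) $$ (i,j) / fact r" for i r
  obtain K where K: "K \<ge> 0" "\<And>r i j. i < n \<Longrightarrow> j < n \<Longrightarrow> \<bar>(A ^\<^sub>m r) $$ (i,j)\<bar> \<le> K ^ r"
    using pow_mat_entry_bound[OF A] by metis
  have E: "mat_exp (t \<cdot>\<^sub>m A) $$ (i,j) = (\<Sum>r. c i r * t ^ r)" if "i < n" for i t
    using that j A by (simp add: mat_exp_def smult_pow_mat_index[OF A] c_def mult.commute)
  have sm: "summable (\<lambda>r. c i r * t ^ r)" if i: "i < n" for i and t :: real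
  proof (rule summable_comparison_test'[of "\<lambda>r. inverse (fact r) * (K * \<bar>t\<bar>) ^ r" 0])
    show "summable (\<lambda>r. inverse (fact r) * (K * \<bar>t\<bar>) ^ r)" by (rule summable_exp)
    fix r :: nat
    have "\<bar>(A ^\<^sub>m r) $$ (i,j)\<bar> * \<bar>t\<bar> ^ r \<le> K ^ r * \<bar>t\<bar> ^ r"
      using K(2)[OF i j] by (intro mult_right_mono) auto
    thus "norm (c i r * t ^ r) \<le> inverse (fact r) * (K * \<bar>t\<bar>) ^ r"
      by (simp add: c_def abs_mult power_abs power_mult_distrib divide_simps mult_ac)
  qed
  have dc: "diffs (c i) r = (\<Sum>s<n. A $$ (i,s) * c s r)" for r
  proof -
    have "(A ^\<^sub>m Suc r) $$ (i,j) = (\<Sum>s<n. A $$ (i,s) * (A ^\<^sub>m r) $$ (s,j))"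
      using pow_mat_add[OF A, of 1 r] mult_mat_nth[OF A pow_carrier_mat[OF A] i j] A by simp
    thus ?thesis
      by (simp add: diffs_def c_def sum_divide_distrib sum_distrib_left divide_simps del: pow_mat.simps)
  qed
  have "((\<lambda>t. \<Sum>r. c i r * t ^ r) has_field_derivative (\<Sum>r. diffs (c i) r * t ^ r)) (at t)"
    by (rule termdiffs_strong_converges_everywhere) (rule sm[OF i])
  also have "(\<Sum>r. diffs (c i) r * t ^ r) = (\<Sum>r. \<Sum>s<n. A $$ (i,s) * (c s r * t ^ r))"
    by (simp add: dc sum_distrib_right mult.assoc)
  also have "\<dots> = (\<Sum>s<n. A $$ (i,s) * (\<Sum>r. c s r * t ^ r))"
    using sm by (subst suminf_sum) (auto intro!: summable_mult sum.cong suminf_mult)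
  also have "\<dots> = (\<Sum>s<n. A $$ (i,s) * mat_exp (t \<cdot>\<^sub>m A) $$ (s,j))"
    by (simp add: E)
  finally show ?thesis by (simp add: E[OF i])
qed

section \<open>Connectedness implies controllability\<close>

text \<open>
  The Fredholm alternative once more, now with the coefficients of the columns made explicit: they are
  the targets for the steering polynomials.
\<close>

lemma annihilator_agrees_imp_range:
  fixes A :: "'a::field mat"
  assumes A: "A \<in> carrier_mat n n" and B: "\<And>i \<sigma>. i < q \<Longrightarrow> \<sigma> < p \<Longrightarrow> B i \<sigma> \<in> carrier_mat n 1"
    and kl: "k < q" "l < q"
    and agree: "\<And>y j. ctrb_annihilator q n p A B y \<Longrightarrow> j < n \<Longrightarrow> y k j = y l j"
  shows "\<exists>c. \<forall>i<q. \<forall>j<n. (\<Sum>r<n. \<Sum>\<sigma><p. c r \<sigma> * (A ^\<^sub>m r * B i \<sigma>) $$ (j,0)) =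
    (if i = k then d j else 0) - (if i = l then d j else 0)"
proof -
  define G where "G a s = (A ^\<^sub>m (s div p) * B (a div n) (s mod p)) $$ (a mod n, 0)" for a s
  define g where "g a = (if a div n = k then d (a mod n) else 0) - (if a div n = l then d (a mod n) else 0)" for a
  have "\<exists>x. \<forall>a<q*n. g a = (\<Sum>s<n*p. G a s * x s)"
  proof (rule fredholm_alternative)
    fix y assume "\<And>s. s < n*p \<Longrightarrow> (\<Sum>a<q*n. y a * G a s) = 0"
    hence "\<forall>s<n*p. (\<Sum>a<q*n. y a * G a s) = 0" by blast
    hence "\<forall>r<n. \<forall>\<sigma><p. (\<Sum>i<q. \<Sum>j<n. y (i*n+j) * (A ^\<^sub>m r * B i \<sigma>) $$ (j,0)) = 0"
      unfolding all_blocks by (simp add: sum_blocks G_def)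
    hence "ctrb_annihilator q n p A B (\<lambda>i j. y (i*n+j))"
      by (intro ctrb_annihilator_finite[OF A B, THEN iffD2]) auto
    hence eq: "y (k*n+j) = y (l*n+j)" if "j < n" for j using agree[of "\<lambda>i j. y (i*n+j)" j] that by simp
    have "(\<Sum>a<q*n. y a * g a) = (\<Sum>j<n. \<Sum>i<q. (if i = k then y (i*n+j) * d j else 0) - (if i = l then y (i*n+j) * d j else 0))"
      unfolding sum_blocks by (subst sum.swap) (auto simp: g_def right_diff_distrib intro!: sum.cong)
    also have "\<dots> = 0" using kl by (simp add: sum_subtractf eq)
    finally show "(\<Sum>a<q*n. y a * g a) = 0" .
  qed
  then obtain x where x: "\<forall>a<q*n. g a = (\<Sum>s<n*p. G a s * x s)" by blast
  have "(\<Sum>r<n. \<Sum>\<sigma><p. x (r*p+\<sigma>) * (A ^\<^sub>m r * B i \<sigma>) $$ (j,0)) =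
      (if i = k then d j else 0) - (if i = l then d j else 0)" if "i < q" "j < n" for i j
  proof -
    have "(if i = k then d j else 0) - (if i = l then d j else 0) = g (i*n+j)"
      using that by (simp add: g_def)
    also have "\<dots> = (\<Sum>r<n. \<Sum>\<sigma><p. x (r*p+\<sigma>) * (A ^\<^sub>m r * B i \<sigma>) $$ (j,0))"
      using x block_index_less[OF that] that by (simp add: sum_blocks G_def mult.commute)
    finally show ?thesis by (rule sym)
  qed
  thus ?thesis by (intro exI[of _ "\<lambda>r \<sigma>. x (r*p+\<sigma>)"] allI impI)
qed

text \<open>
  The free motions of nodes \<open>k\<close> and \<open>l\<close> differ by some vector \<open>-2 d\<close> at time 1, and the assumption puts
  \<open>(e\<^sub>k - e\<^sub>l) \<otimes> d\<close> into the range of the controllability matrix. Adding to the free motion the forced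
  motion produced by the steering polynomials of each input moves node \<open>k\<close> by \<open>d\<close>, node \<open>l\<close> by \<open>-d\<close>
  and no other node.
\<close>

theorem annihilator_agrees_imp_controllable:
  assumes rel: "array_rel_act q n p A B" and n: "n \<ge> 1" and kl: "k < q" "l < q" "k \<noteq> l"
    and agree: "\<And>y j. ctrb_annihilator q n p A B y \<Longrightarrow> j < n \<Longrightarrow> y k j = y l j"
  shows "pair_controllable q n p k l A B"
  unfolding pair_controllable_def
proof (intro allI impI)
  fix x0 :: "nat \<Rightarrow> real vec" assume "\<forall>i<q. x0 i \<in> carrier_vec n"
  hence x0: "x0 i \<in> carrier_vec n" if "i < q" for i using that by blast
  have A: "A \<in> carrier_mat n n" and B: "\<And>i \<sigma>. i < q \<Longrightarrow> \<sigma> < p \<Longrightarrow> B i \<sigma> \<in> carrier_mat n 1"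
    using rel by (auto simp: array_rel_act_def)
  define E where "E t a b = mat_exp (t \<cdot>\<^sub>m A) $$ (a,b)" for t a b
  define free where "free i t j = (\<Sum>b<n. E t j b * x0 i $ b)" for i t j
  \<comment> \<open>the nodes meet halfway, which is forced since the sum of all states evolves freely\<close>
  define d where "d j = - (free k 1 j - free l 1 j) / 2" for j
  have "\<exists>c. \<forall>i<q. \<forall>j<n. (\<Sum>r<n. \<Sum>\<sigma><p. c r \<sigma> * (A ^\<^sub>m r * B i \<sigma>) $$ (j,0)) =
      (if i = k then d j else 0) - (if i = l then d j else 0)"
    by (rule annihilator_agrees_imp_range[OF A _ kl(1,2)]) (rule B agree; assumption)+
  then obtain c where c: "\<forall>i<q. \<forall>j<n. (\<Sum>r<n. \<Sum>\<sigma><p. c r \<sigma> * (A ^\<^sub>m r * B i \<sigma>) $$ (j,0)) =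
      (if i = k then d j else 0) - (if i = l then d j else 0)" by blast
  let ?a = "coeff (char_poly A)"
  have an: "?a n = 1" using degree_monic_char_poly[OF A] by simp
  define steers where "steers \<alpha> \<phi> u \<longleftrightarrow> (\<forall>r<n. poly (\<phi> r) 0 = 0) \<and> (\<forall>r<n. poly (\<phi> r) 1 = \<alpha> r) \<and>
      (\<forall>v t. (\<Sum>r\<le>n. ?a r * v r) = 0 \<longrightarrow>
        (\<Sum>r<n. poly (pderiv (\<phi> r)) t * v r) = (\<Sum>r<n. poly (\<phi> r) t * v (Suc r)) + poly u t * v 0)"
    for \<alpha> :: "nat \<Rightarrow> real" and \<phi> :: "nat \<Rightarrow> real poly" and u :: "real poly"
  have "\<exists>\<phi> u. steers (\<lambda>r. c r \<sigma>) \<phi> u" for \<sigma>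
    unfolding steers_def by (rule companion_steering[of n ?a "\<lambda>r. c r \<sigma>", OF n an]) blast
  then obtain \<phi> u where steer: "\<And>\<sigma>. steers (\<lambda>r. c r \<sigma>) (\<phi> \<sigma>) (u \<sigma>)" by metis
  note steer' = steer[unfolded steers_def]
  note \<phi>0 = steer'[THEN conjunct1, rule_format]
    and \<phi>1 = steer'[THEN conjunct2, THEN conjunct1, rule_format]
    and \<phi> = steer'[THEN conjunct2, THEN conjunct2, rule_format]
  define V where "V i \<sigma> j r = (A ^\<^sub>m r * B i \<sigma>) $$ (j,0)" for i \<sigma> j r
  define X where "X i t j = free i t j + (\<Sum>\<sigma><p. \<Sum>r<n. poly (\<phi> \<sigma> r) t * V i \<sigma> j r)" for i t j
  have V0: "V i \<sigma> j 0 = B i \<sigma> $$ (j,0)" if "i < q" "\<sigma> < p" "j < n" for i \<sigma> j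
    using left_mult_one_mat[OF B[OF that(1,2)]] A by (simp add: V_def)
  have VS: "V i \<sigma> j (Suc r) = (\<Sum>b<n. A $$ (j,b) * V i \<sigma> b r)" if "i < q" "\<sigma> < p" "j < n" for i \<sigma> j r
  proof -
    have "A ^\<^sub>m Suc r * B i \<sigma> = A * (A ^\<^sub>m r * B i \<sigma>)"
      using pow_mat_add[OF A, of 1 r] A assoc_mult_mat[OF A pow_carrier_mat[OF A, of r] B[OF that(1,2)]] by simp
    thus ?thesis unfolding V_def
      using mult_mat_nth[OF A mult_carrier_mat[OF pow_carrier_mat[OF A, of r] B[OF that(1,2)]] that(3)] by simp
  qed
  have CH: "(\<Sum>r\<le>n. ?a r * V i \<sigma> j r) = 0" if "i < q" "\<sigma> < p" "j < n" for i \<sigma> j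
    unfolding V_def by (rule char_poly_recurrence[OF A B[OF that(1,2)] that(3)]) simp
  have der: "((\<lambda>t. X i t j) has_field_derivative
      (\<Sum>b<n. A $$ (j,b) * X i t b) + (\<Sum>\<sigma><p. B i \<sigma> $$ (j,0) * poly (u \<sigma>) t)) (at t)"
    if i: "i < q" and j: "j < n" for i j t
  proof -
    have "((\<lambda>t. X i t j) has_field_derivative
        (\<Sum>b<n. (\<Sum>s<n. A $$ (j,s) * E t s b) * x0 i $ b) +
        (\<Sum>\<sigma><p. \<Sum>r<n. poly (pderiv (\<phi> \<sigma> r)) t * V i \<sigma> j r)) (at t)"
      unfolding X_def free_def E_def
      by (intro DERIV_add DERIV_sum DERIV_cmult_right mat_exp_deriv[OF A j] poly_DERIV) auto
    also have "(\<Sum>b<n. (\<Sum>s<n. A $$ (j,s) * E t s b) * x0 i $ b) = (\<Sum>s<n. A $$ (j,s) * free i t s)"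
      unfolding free_def sum_distrib_left sum_distrib_right by (subst sum.swap) (simp add: mult.assoc)
    also have "(\<Sum>\<sigma><p. \<Sum>r<n. poly (pderiv (\<phi> \<sigma> r)) t * V i \<sigma> j r) =
        (\<Sum>\<sigma><p. (\<Sum>b<n. A $$ (j,b) * (\<Sum>r<n. poly (\<phi> \<sigma> r) t * V i \<sigma> b r)) + B i \<sigma> $$ (j,0) * poly (u \<sigma>) t)"
    proof (rule sum.cong[OF refl])
      fix \<sigma> assume "\<sigma> \<in> {..<p}"
      hence \<sigma>: "\<sigma> < p" by simp
      have "(\<Sum>r<n. poly (\<phi> \<sigma> r) t * V i \<sigma> j (Suc r)) = (\<Sum>b<n. A $$ (j,b) * (\<Sum>r<n. poly (\<phi> \<sigma> r) t * V i \<sigma> b r))"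
        unfolding VS[OF i \<sigma> j] sum_distrib_left by (subst sum.swap) (simp add: mult.left_commute)
      thus "(\<Sum>r<n. poly (pderiv (\<phi> \<sigma> r)) t * V i \<sigma> j r) =
          (\<Sum>b<n. A $$ (j,b) * (\<Sum>r<n. poly (\<phi> \<sigma> r) t * V i \<sigma> b r)) + B i \<sigma> $$ (j,0) * poly (u \<sigma>) t"
        using \<phi>[OF CH[OF i \<sigma> j], of \<sigma> t] V0[OF i \<sigma> j] by (simp add: mult.commute)
    qed
    also have "(\<Sum>s<n. A $$ (j,s) * free i t s) + \<dots> =
        (\<Sum>b<n. A $$ (j,b) * X i t b) + (\<Sum>\<sigma><p. B i \<sigma> $$ (j,0) * poly (u \<sigma>) t)"
    proof -
      have "(\<Sum>\<sigma><p. \<Sum>b<n. A $$ (j,b) * (\<Sum>r<n. poly (\<phi> \<sigma> r) t * V i \<sigma> b r)) =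
          (\<Sum>b<n. A $$ (j,b) * (\<Sum>\<sigma><p. \<Sum>r<n. poly (\<phi> \<sigma> r) t * V i \<sigma> b r))"
        by (subst sum.swap) (simp add: sum_distrib_left)
      thus ?thesis by (simp add: X_def distrib_left sum.distrib)
    qed
    finally show ?thesis .
  qed
  define x where "x i t = vec n (X i t)" for i t
  have xc: "x i t \<in> carrier_vec n" for i t by (simp add: x_def)
  have traj: "array_trajectory q n p A B 1 (\<lambda>\<sigma>. poly (u \<sigma>)) x"
    unfolding array_trajectory_def
  proof (intro allI impI ballI conjI)
    fix i t j assume i: "i < q" and t: "t \<in> {0..1::real}" and j: "j < n"
    have "((\<lambda>s. (\<Sum>b<n. A $$ (j,b) * X i s b) + (\<Sum>\<sigma><p. B i \<sigma> $$ (j,0) * poly (u \<sigma>) s))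
        has_integral X i t j - X i 0 j) {0..t}"
      using t der[OF i j]
      by (intro fundamental_theorem_of_calculus)
         (auto simp: has_real_derivative_iff_has_vector_derivative[symmetric] intro: DERIV_subset)
    moreover have "(A *\<^sub>v x i s) $ j = (\<Sum>b<n. A $$ (j,b) * X i s b)" for s
      unfolding mult_mat_vec_nth[OF A xc j] by (simp add: x_def)
    ultimately show "((\<lambda>s. (A *\<^sub>v x i s) $ j + (\<Sum>\<sigma><p. B i \<sigma> $$ (j,0) * poly (u \<sigma>) s))
        has_integral x i t $ j - x i 0 $ j) {0..t}"
      using j by (simp add: x_def del: index_mult_mat_vec)
  qed (rule xc)
  have init: "x i 0 = x0 i" if i: "i < q" for i
  proof (rule eq_vecI)
    fix j assume "j < dim_vec (x0 i)"
    hence j: "j < n" using x0[OF i] by simp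
    have "free i 0 j = x0 i $ j"
      using j by (simp add: free_def E_def mat_exp_at_0[OF A] if_distrib[of "\<lambda>x. x * _"] cong: if_cong)
    thus "x i 0 $ j = x0 i $ j" using j by (simp add: x_def X_def \<phi>0)
  qed (use x0[OF i] in \<open>simp add: x_def\<close>)
  have X1: "X i 1 j = free i 1 j + (if i = k then d j else 0) - (if i = l then d j else 0)"
    if "i < q" "j < n" for i j
  proof -
    have "(\<Sum>\<sigma><p. \<Sum>r<n. poly (\<phi> \<sigma> r) 1 * V i \<sigma> j r) = (\<Sum>r<n. \<Sum>\<sigma><p. c r \<sigma> * V i \<sigma> j r)"
      by (subst sum.swap) (simp add: \<phi>1)
    thus ?thesis using c that by (simp add: X_def V_def)
  qed
  have meet: "x k 1 = x l 1"
    using kl by (intro eq_vecI) (auto simp: x_def X1 d_def field_simps)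
  have rest: "x i 1 = mat_exp (1 \<cdot>\<^sub>m A) *\<^sub>v x0 i" if i: "i < q" "i \<noteq> k" "i \<noteq> l" for i
  proof -
    have e: "mat_exp (1 \<cdot>\<^sub>m A) \<in> carrier_mat n n" using A by (simp add: mat_exp_def)
    show ?thesis
    proof (rule eq_vecI)
      fix j assume "j < dim_vec (mat_exp (1 \<cdot>\<^sub>m A) *\<^sub>v x0 i)"
      hence j: "j < n" using e by simp
      show "x i 1 $ j = (mat_exp (1 \<cdot>\<^sub>m A) *\<^sub>v x0 i) $ j"
        unfolding mult_mat_vec_nth[OF e x0[OF i(1)] j] using i j by (simp add: x_def X1 free_def E_def)
    qed (use e in \<open>simp add: x_def\<close>)
  qed
  have "poly (u \<sigma>) absolutely_integrable_on {0..1}" for \<sigma>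
    by (rule absolutely_integrable_continuous_real) (intro continuous_intros)
  thus "\<exists>\<tau> u x. \<tau> > 0 \<and> (\<forall>\<sigma><p. u \<sigma> absolutely_integrable_on {0..\<tau>}) \<and>
          array_trajectory q n p A B \<tau> u x \<and> (\<forall>i<q. x i 0 = x0 i) \<and> x k \<tau> = x l \<tau> \<and>
          (\<forall>i<q. i \<noteq> k \<longrightarrow> i \<noteq> l \<longrightarrow> x i \<tau> = mat_exp (\<tau> \<cdot>\<^sub>m A) *\<^sub>v x0 i)"
    using traj init meet rest by (intro exI[of _ 1] exI[of _ "\<lambda>\<sigma>. poly (u \<sigma>)"] exI[of _ x]) auto
qed

section \<open>The equivalence\<close>

theorem theorem3:
  fixes q n p k l m :: nat
    and A :: "real mat" and B :: "nat \<Rightarrow> nat \<Rightarrow> real mat"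
    and \<mu> :: "nat \<Rightarrow> complex" and N :: "nat \<Rightarrow> nat"
    and U Ak :: "nat \<Rightarrow> complex mat"
  assumes "q \<ge> 2" and "n \<ge> 1" and "p \<ge> 1"
    and "array_rel_act q n p A B"
    and "gen_eigen_data n A m \<mu> N U Ak"
    and "k < q" and "l < q" and "k \<noteq> l"
  shows "(pair_controllable q n p k l A B \<longleftrightarrow>
            pair_connected q n k l (array_ctrb q n p A B)) \<and>
         (pair_connected q n k l (array_ctrb q n p A B) \<longleftrightarrow>
            (\<forall>\<kappa><m. pair_connected q (N \<kappa>) k l (modal_inc q p (N \<kappa>) (U \<kappa>) (Ak \<kappa>) B)))"
proof
  note rel = \<open>array_rel_act q n p A B\<close> and kl = \<open>k < q\<close> \<open>l < q\<close>
  show "pair_controllable q n p k l A B \<longleftrightarrow> pair_connected q n k l (array_ctrb q n p A B)"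
    unfolding array_ctrb_connected_iff[OF rel kl]
    using controllable_imp_annihilator_agrees[OF rel kl \<open>k \<noteq> l\<close>]
      annihilator_agrees_imp_controllable[OF rel \<open>n \<ge> 1\<close> kl \<open>k \<noteq> l\<close>] by blast
  show "pair_connected q n k l (array_ctrb q n p A B) \<longleftrightarrow>
      (\<forall>\<kappa><m. pair_connected q (N \<kappa>) k l (modal_inc q p (N \<kappa>) (U \<kappa>) (Ak \<kappa>) B))"
    by (rule array_ctrb_connected_iff_modal[OF rel \<open>gen_eigen_data n A m \<mu> N U Ak\<close> kl])
qed

end
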